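(* Let $(P,R)$ be a tame Fredholm pair, let $T=RP+(\mathrm{Id}-R)(\mathrm{Id}-P)$, and let $U$ be a parametrix for $T$ with $TU=\mathrm{Id}-K_1$, $UT=\mathrm{Id}-K_2$, where $K_1,K_2$ are smoothing operators. Then $$\operatorname{R-Ind}(P,R)=\operatorname{tr}_{H_0}(PK_2P)-\operatorname{tr}_{H_0}(RK_1R).$$
   Context: Fix a family of separable Hilbert spaces $(H_s,\|\cdot\|_s)$, $s\in\mathbb R$, such that for $s<t$ we have $H_t\subset H_s$ and $\|x\|_s\le\|x\|_t$ for $x\in H_t$. Let $H_\infty=\bigcap_sH_s$, assumed dense in every $H_s$, and $H_{-\infty}=\bigcup_sH_s$. The inner product $\langle\cdot,\cdot\rangle$ of $H_0$ is assumed to satisfy $|\langle x,y\rangle|\le\|x\|_s\|y\|_{-s}$ for $x,y\in H_\infty$, and via this pairing $H_s'\simeq H_{-s}$. A tame operator of order $m\in\mathbb R$ is a linear operator $T$ on $H_{-\infty}$ such that for every $s$, $TH_s\subset H_{s-m}$ and $T:H_s\to H_{s-m}$ is bounded. Its formal adjoint $T^*$ is defined by $\langle Tx,y\rangle=\langle x,T^*y\rangle$. A smoothing operator is a tame operator mapping $H_{-\infty}$ to $H_\infty$; it is assumed that smoothing operators are trace class on each $H_s$. A tame operator $T$ is tamely elliptic if there is a tame operator $U$ (a parametrix) with $TU=\mathrm{Id}-K_1$, $UT=\mathrm{Id}-K_2$, $K_1,K_2$ smoothing. Standing assumption: if $T$ is tame of non-positive order, then $\mathrm{Id}+T^*T$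 is tamely elliptic. For a tame operator $U$, $\operatorname{Dom}_0(U)$ is the set of $x\in H_0$ for which there is a sequence $x_n\in H_\infty$ with $x_n\to x$ and $Ux_n\to Ux$ in $H_0$; it is a Hilbert space with inner product $\langle x,y\rangle+\langle Ux,Uy\rangle$. A tame projection is a tame operator $P$ of order $0$ with $P^2=P$. A pair $(P,R)$ of tame projections is a tame Fredholm pair if $T=RP+(\mathrm{Id}-R)(\mathrm{Id}-P)$ is tamely elliptic; $U$ denotes a parametrix for $T$. Then $RP:H_0\cap\operatorname{range}P\to\operatorname{Dom}_0(U)\cap\operatorname{range}R$ is Fredholm, and $\operatorname{R-Ind}(P,R)$ denotes its index. $\operatorname{tr}_{H_0}$ is the operator trace on $H_0$. *)

theory Defs
  imports "HOL-Analysis.Analysis"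
begin

section \<open>Complex Hilbert spaces carried by subspaces of an ambient vector space\<close>

definition nrm :: "('a \<Rightarrow> 'a \<Rightarrow> complex) \<Rightarrow> 'a \<Rightarrow> real" where
  "nrm ip x = sqrt (Re (ip x x))"

definition converges_in ::
    "'a::ab_group_add set \<Rightarrow> ('a \<Rightarrow> 'a \<Rightarrow> complex) \<Rightarrow> (nat \<Rightarrow> 'a) \<Rightarrow> 'a \<Rightarrow> bool" where
  "converges_in V ip X x \<longleftrightarrow>
     (\<forall>n. X n \<in> V) \<and> x \<in> V \<and> (\<lambda>n. nrm ip (X n - x)) \<longlonglongrightarrow> 0"

definition cauchy_in ::
    "'a::ab_group_add set \<Rightarrow> ('a \<Rightarrow> 'a \<Rightarrow> complex) \<Rightarrow> (nat \<Rightarrow> 'a) \<Rightarrow> bool" where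
  "cauchy_in V ip X \<longleftrightarrow>
     (\<forall>n. X n \<in> V) \<and> (\<forall>e>0. \<exists>N. \<forall>m\<ge>N. \<forall>n\<ge>N. nrm ip (X m - X n) < e)"

definition dense_in ::
    "'a::ab_group_add set \<Rightarrow> ('a \<Rightarrow> 'a \<Rightarrow> complex) \<Rightarrow> 'a set \<Rightarrow> bool" where
  "dense_in V ip D \<longleftrightarrow>
     D \<subseteq> V \<and> (\<forall>x\<in>V. \<forall>e>0. \<exists>y\<in>D. nrm ip (x - y) < e)"

locale complex_vector_space = vector_space scale
  for scale :: "complex \<Rightarrow> 'a::ab_group_add \<Rightarrow> 'a"  (infixr \<open>*s\<close> 75)
begin

definition linear_on :: "'a set \<Rightarrow> ('a \<Rightarrow> 'a) \<Rightarrow> bool" where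
  "linear_on V T \<longleftrightarrow>
     (\<forall>x\<in>V. \<forall>y\<in>V. T (x + y) = T x + T y) \<and> (\<forall>c. \<forall>x\<in>V. T (c *s x) = c *s T x)"

definition finite_dim :: "'a set \<Rightarrow> bool" where
  "finite_dim V \<longleftrightarrow> (\<exists>B. finite B \<and> span B = V)"

text \<open>For subspaces \<open>Z \<subseteq> Y\<close>, the classes of the elements of \<open>B\<close> form a finite basis of the
  quotient space \<open>Y / Z\<close> (and distinct elements of \<open>B\<close> have distinct classes).\<close>

definition quotient_basis :: "'a set \<Rightarrow> 'a set \<Rightarrow> 'a set \<Rightarrow> bool" where
  "quotient_basis Y Z B \<longleftrightarrow>
     finite B \<and> B \<subseteq> Y \<and> span (Z \<union> B) = Y \<and>
     (\<forall>c. (\<Sum>b\<in>B. c b *s b) \<in> Z \<longrightarrow> (\<forall>b\<in>B. c b = 0))"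

definition quotient_dim :: "'a set \<Rightarrow> 'a set \<Rightarrow> nat" where
  "quotient_dim Y Z = (THE n. \<exists>B. quotient_basis Y Z B \<and> card B = n)"

text \<open>Fredholm maps \<open>A : (X, nX) \<rightarrow> (Y, nY)\<close> of normed spaces.  Closedness of the range is not
  demanded: for complete spaces it follows from finite codimension.\<close>

definition fredholm ::
    "'a set \<Rightarrow> ('a \<Rightarrow> real) \<Rightarrow> 'a set \<Rightarrow> ('a \<Rightarrow> real) \<Rightarrow> ('a \<Rightarrow> 'a) \<Rightarrow> bool" where
  "fredholm X nX Y nY A \<longleftrightarrow>
     A ` X \<subseteq> Y \<and> linear_on X A \<and> (\<exists>C. \<forall>x\<in>X. nY (A x) \<le> C * nX x) \<and>
     finite_dim {x \<in> X. A x = 0} \<and> (\<exists>B. quotient_basis Y (A ` X) B)"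

definition fredholm_index ::
    "'a set \<Rightarrow> ('a \<Rightarrow> real) \<Rightarrow> 'a set \<Rightarrow> ('a \<Rightarrow> real) \<Rightarrow> ('a \<Rightarrow> 'a) \<Rightarrow> int" where
  "fredholm_index X nX Y nY A =
     (if fredholm X nX Y nY A
      then int (dim {x \<in> X. A x = 0}) - int (quotient_dim Y (A ` X))
      else undefined)"

end

text \<open>Inner products are linear in the first argument.\<close>

locale hilbert_space_on = complex_vector_space scale
  for scale :: "complex \<Rightarrow> 'a::ab_group_add \<Rightarrow> 'a"  (infixr \<open>*s\<close> 75) +
  fixes V :: "'a set" and ip :: "'a \<Rightarrow> 'a \<Rightarrow> complex"
  assumes subspace_V: "subspace V"
    and ip_add: "\<lbrakk>x \<in> V; y \<in> V; z \<in> V\<rbrakk> \<Longrightarrow> ip (x + y) z = ip x z + ip y z"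
    and ip_scale: "\<lbrakk>x \<in> V; y \<in> V\<rbrakk> \<Longrightarrow> ip (c *s x) y = c * ip x y"
    and ip_cnj: "\<lbrakk>x \<in> V; y \<in> V\<rbrakk> \<Longrightarrow> ip y x = cnj (ip x y)"
    and ip_pos: "\<lbrakk>x \<in> V; x \<noteq> 0\<rbrakk> \<Longrightarrow> Re (ip x x) > 0"
    and complete_V: "cauchy_in V ip X \<Longrightarrow> \<exists>x. converges_in V ip X x"
    and separable_V: "\<exists>D. countable D \<and> dense_in V ip D"
begin

definition bounded_op :: "('a \<Rightarrow> 'a) \<Rightarrow> bool" where
  "bounded_op T \<longleftrightarrow>
     T ` V \<subseteq> V \<and> linear_on V T \<and> (\<exists>C. \<forall>x\<in>V. nrm ip (T x) \<le> C * nrm ip x)"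

definition bounded_functional :: "('a \<Rightarrow> complex) \<Rightarrow> bool" where
  "bounded_functional f \<longleftrightarrow>
     (\<forall>x\<in>V. \<forall>y\<in>V. f (x + y) = f x + f y) \<and> (\<forall>c. \<forall>x\<in>V. f (c *s x) = c * f x) \<and>
     (\<exists>C. \<forall>x\<in>V. cmod (f x) \<le> C * nrm ip x)"

definition orthonormal_basis :: "'a set \<Rightarrow> bool" where
  "orthonormal_basis E \<longleftrightarrow>
     E \<subseteq> V \<and> (\<forall>e\<in>E. \<forall>f\<in>E. ip e f = (if e = f then 1 else 0)) \<and> dense_in V ip (span E)"

definition positive_op :: "('a \<Rightarrow> 'a) \<Rightarrow> bool" where
  "positive_op A \<longleftrightarrow>
     bounded_op A \<and> (\<forall>x\<in>V. Im (ip (A x) x) = 0 \<and> Re (ip (A x) x) \<ge> 0)"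

text \<open>\<open>A\<close> is the absolute value of \<open>T\<close>: the positive operator with \<open>A\<^sup>2 = T\<^sup>* T\<close>, the latter
  equation being tested against vectors.\<close>

definition is_absolute_value :: "('a \<Rightarrow> 'a) \<Rightarrow> ('a \<Rightarrow> 'a) \<Rightarrow> bool" where
  "is_absolute_value T A \<longleftrightarrow>
     positive_op A \<and> (\<forall>x\<in>V. \<forall>y\<in>V. ip (A (A x)) y = ip (T x) (T y))"

definition trace_class :: "('a \<Rightarrow> 'a) \<Rightarrow> bool" where
  "trace_class T \<longleftrightarrow>
     bounded_op T \<and>
     (\<exists>A E. is_absolute_value T A \<and> orthonormal_basis E \<and>
            (\<lambda>e. Re (ip (A e) e)) summable_on E)"

text \<open>The common value of \<open>\<Sum>e\<in>E. \<langle>T e, e\<rangle>\<close> over all orthonormal bases \<open>E\<close>.\<close>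

definition op_trace :: "('a \<Rightarrow> 'a) \<Rightarrow> complex" where
  "op_trace T = (THE c. \<forall>E. orthonormal_basis E \<longrightarrow> ((\<lambda>e. ip (T e) e) has_sum c) E)"

end

section \<open>Scales of Hilbert spaces and tame operators\<close>

text \<open>The ambient type plays the role of \<open>H\<^sub>-\<^sub>\<infinity>\<close>, so that operators on \<open>H\<^sub>-\<^sub>\<infinity>\<close> are functions
  on this type.\<close>

locale hilbert_scale = complex_vector_space scale
  for scale :: "complex \<Rightarrow> 'a::ab_group_add \<Rightarrow> 'a"  (infixr \<open>*s\<close> 75) +
  fixes H :: "real \<Rightarrow> 'a set" and ip :: "real \<Rightarrow> 'a \<Rightarrow> 'a \<Rightarrow> complex"
  assumes hilbert: "hilbert_space_on scale (H s) (ip s)"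
    and H_decreasing: "s < t \<Longrightarrow> H t \<subseteq> H s"
    and nrm_increasing: "\<lbrakk>s < t; x \<in> H t\<rbrakk> \<Longrightarrow> nrm (ip s) x \<le> nrm (ip t) x"
    and Un_H: "(\<Union>s. H s) = UNIV"
begin

definition H_inf :: "'a set" where
  "H_inf = (\<Inter>s. H s)"

text \<open>The extension by continuity of the inner product of \<open>H\<^sub>0\<close> from \<open>H\<^sub>\<infinity> \<times> H\<^sub>\<infinity>\<close> to
  \<open>H\<^sub>s \<times> H\<^sub>-\<^sub>s\<close>.\<close>

definition pairing :: "real \<Rightarrow> 'a \<Rightarrow> 'a \<Rightarrow> complex" where
  "pairing s x y =
     (THE c. \<forall>X Y. range X \<subseteq> H_inf \<and> range Y \<subseteq> H_inf \<and>
                   converges_in (H s) (ip s) X x \<and> converges_in (H (- s)) (ip (- s)) Y y \<longrightarrow>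
                   (\<lambda>n. ip 0 (X n) (Y n)) \<longlonglongrightarrow> c)"

definition tame :: "real \<Rightarrow> ('a \<Rightarrow> 'a) \<Rightarrow> bool" where
  "tame m T \<longleftrightarrow>
     Vector_Spaces.linear scale scale T \<and>
     (\<forall>s. T ` H s \<subseteq> H (s - m) \<and>
          (\<exists>C. \<forall>x\<in>H s. nrm (ip (s - m)) (T x) \<le> C * nrm (ip s) x))"

definition tame_operator :: "('a \<Rightarrow> 'a) \<Rightarrow> bool" where
  "tame_operator T \<longleftrightarrow> (\<exists>m. tame m T)"

definition formal_adjoint :: "('a \<Rightarrow> 'a) \<Rightarrow> ('a \<Rightarrow> 'a) \<Rightarrow> bool" where
  "formal_adjoint T T' \<longleftrightarrow>
     tame_operator T' \<and> (\<forall>x\<in>H_inf. \<forall>y\<in>H_inf. ip 0 (T x) y = ip 0 x (T' y))"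

definition smoothing :: "('a \<Rightarrow> 'a) \<Rightarrow> bool" where
  "smoothing K \<longleftrightarrow> tame_operator K \<and> range K \<subseteq> H_inf"

definition parametrix ::
    "('a \<Rightarrow> 'a) \<Rightarrow> ('a \<Rightarrow> 'a) \<Rightarrow> ('a \<Rightarrow> 'a) \<Rightarrow> ('a \<Rightarrow> 'a) \<Rightarrow> bool" where
  "parametrix T U K1 K2 \<longleftrightarrow>
     tame_operator U \<and> smoothing K1 \<and> smoothing K2 \<and>
     (\<forall>x. T (U x) = x - K1 x) \<and> (\<forall>x. U (T x) = x - K2 x)"

definition tamely_elliptic :: "('a \<Rightarrow> 'a) \<Rightarrow> bool" where
  "tamely_elliptic T \<longleftrightarrow> tame_operator T \<and> (\<exists>U K1 K2. parametrix T U K1 K2)"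

definition Dom0 :: "('a \<Rightarrow> 'a) \<Rightarrow> 'a set" where
  "Dom0 U = {x. \<exists>X. range X \<subseteq> H_inf \<and> converges_in (H 0) (ip 0) X x \<and>
                    converges_in (H 0) (ip 0) (\<lambda>n. U (X n)) (U x)}"

definition Dom0_ip :: "('a \<Rightarrow> 'a) \<Rightarrow> 'a \<Rightarrow> 'a \<Rightarrow> complex" where
  "Dom0_ip U x y = ip 0 x y + ip 0 (U x) (U y)"

definition tame_projection :: "('a \<Rightarrow> 'a) \<Rightarrow> bool" where
  "tame_projection P \<longleftrightarrow> tame 0 P \<and> P \<circ> P = P"

definition pair_op :: "('a \<Rightarrow> 'a) \<Rightarrow> ('a \<Rightarrow> 'a) \<Rightarrow> 'a \<Rightarrow> 'a" where
  "pair_op P R x = R (P x) + ((x - P x) - R (x - P x))"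

definition tame_fredholm_pair :: "('a \<Rightarrow> 'a) \<Rightarrow> ('a \<Rightarrow> 'a) \<Rightarrow> bool" where
  "tame_fredholm_pair P R \<longleftrightarrow>
     tame_projection P \<and> tame_projection R \<and> tamely_elliptic (pair_op P R)"

text \<open>The parametrix \<open>U\<close> of \<open>pair_op P R\<close> enters only through \<open>Dom0 U\<close>, which is the same for
  all parametrices, as two of them differ by a smoothing operator.\<close>

definition R_Ind :: "('a \<Rightarrow> 'a) \<Rightarrow> ('a \<Rightarrow> 'a) \<Rightarrow> ('a \<Rightarrow> 'a) \<Rightarrow> int" where
  "R_Ind U P R =
     fredholm_index (H 0 \<inter> range P) (nrm (ip 0)) (Dom0 U \<inter> range R) (nrm (Dom0_ip U)) (R \<circ> P)"

definition trace_H0 :: "('a \<Rightarrow> 'a) \<Rightarrow> complex" where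
  "trace_H0 A = hilbert_space_on.op_trace scale (H 0) (ip 0) A"

end

text \<open>The assumption \<open>duality\<close> says that \<open>y \<mapsto> \<langle>\<cdot>, y\<rangle>\<close> is a bijection of \<open>H\<^sub>-\<^sub>s\<close> onto
  the dual of \<open>H\<^sub>s\<close>; its continuity is \<open>pairing_bound\<close>, that of its inverse the open mapping
  theorem.  It is not required to be isometric.\<close>

locale tame_setting = hilbert_scale scale H ip
  for scale :: "complex \<Rightarrow> 'a::ab_group_add \<Rightarrow> 'a"  (infixr \<open>*s\<close> 75)
    and H :: "real \<Rightarrow> 'a set" and ip :: "real \<Rightarrow> 'a \<Rightarrow> 'a \<Rightarrow> complex" +
  assumes H_inf_dense: "dense_in (H s) (ip s) H_inf"
    and pairing_bound:
      "\<lbrakk>x \<in> H_inf; y \<in> H_inf\<rbrakk> \<Longrightarrow> cmod (ip 0 x y) \<le> nrm (ip s) x * nrm (ip (- s)) y"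
    and duality:
      "hilbert_space_on.bounded_functional scale (H s) (ip s) f \<Longrightarrow>
         \<exists>!y. y \<in> H (- s) \<and> (\<forall>x\<in>H s. f x = pairing s x y)"
    and smoothing_trace_class:
      "smoothing K \<Longrightarrow> hilbert_space_on.trace_class scale (H s) (ip s) K"
    and elliptic_Id_plus:
      "\<lbrakk>m \<le> 0; tame m T; formal_adjoint T T'\<rbrakk> \<Longrightarrow> tamely_elliptic (\<lambda>x. x + T' (T x))"

end

theory Submission
  imports Defs
begin

text \<open>Put \<open>A = RP\<close>, \<open>B = PUR\<close>, \<open>S1 = R K1 R\<close>, \<open>S2 = P K2 P\<close>.  Since \<open>R T = T P = A\<close>, one has \<open>A B = Id - S1\<close> on
  the range of \<open>R\<close> and \<open>B A = Id - S2\<close> on that of \<open>P\<close>.  Splitting \<open>S1 = F + G\<close> with \<open>F\<close> of finite rank and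
  \<open>\<parallel>G\<parallel> < 1\<close>, one replaces \<open>B\<close> by \<open>B (Id - G)\<^sup>-\<^sup>1 = B + D\<close>, which is inverse to \<open>A\<close> up to the
  operators \<open>F1 = S1 - A D\<close> and \<open>F2 = S2 - D A\<close> of finite rank.  As \<open>D\<close> is nuclear,
  \<open>tr (A D) = tr (D A)\<close>, so \<open>tr S2 - tr S1 = tr F2 - tr F1\<close>.  Let \<open>Y0\<close> be a finite-dimensional space of
  smooth vectors in the range of \<open>R\<close> containing the range of \<open>F1\<close>, and \<open>X0\<close> its preimage under \<open>A\<close>
  among the smooth vectors in the range of \<open>P\<close>.  Then \<open>F2\<close> maps into \<open>X0\<close>, so both traces can be
  computed on \<open>X0\<close> and \<open>Y0\<close>, where \<open>A (B + D)\<close> and \<open>(B + D) A\<close> have equal trace; hence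
  \<open>tr F2 - tr F1 = dim X0 - dim Y0\<close>.  This is also the index, because \<open>X0\<close> contains the kernel of
  \<open>A\<close> and \<open>Y0\<close> is mapped onto its cokernel.

  That trace class operators are nuclear is shown without square roots or a spectral theorem,
  by a Cholesky decomposition of the absolute value.\<close>

section \<open>Subspaces, rank and nullity, quotients\<close>

text \<open>The parametrix may have positive order, so \<open>B\<close> need not be bounded on
  \<open>H 0\<close>, and cyclicity of the trace cannot be applied to \<open>A\<close> and
  \<open>B\<close> directly. What saves the argument is that (Id - G)^-1 = Id + G (Id - G)^-1: the
  correction \<open>D\<close> contains the factor \<open>G\<close>, although the Neumann inverse
  itself is merely bounded on \<open>H 0\<close> and says nothing about smoothness. For this
  \<open>G\<close> must have smooth values, and so the nuclear expansion of a smoothing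
  \<open>K\<close> is built from vectors \<open>K (g k)\<close> rather than arbitrary ones.
  Truncating the expansion of \<open>S1\<close> then gives a finite-rank \<open>F\<close> with
  values among the smooth vectors in the range of \<open>R\<close>, and \<open>B G\<close> is a
  smoothing operator minus one of finite rank. The same possible unboundedness explains the target
  space \<open>Dom0 U\<close>: its elements w have U w in \<open>H 0\<close>, which puts
  \<open>B w\<close> back into \<open>H 0\<close> when w is decomposed modulo the range of
  \<open>A\<close>. Elliptic regularity lets kernel and cokernel be computed among smooth vectors,
  where domains are no issue.\<close>

lemma (in vector_space) independent_Un_span_Int:
  assumes ind: "independent (A \<union> B)" and disj: "A \<inter> B = {}"
    and xA: "x \<in> span A" and xB: "x \<in> span B"
  shows "x = 0"
proof -
  \<comment> \<open>The coordinates of \<open>x\<close> are supported both in \<open>A\<close> and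
    in \<open>B\<close>, so all of them vanish.\<close>
  have eqA: "representation (A \<union> B) x = representation A x"
    using representation_extend[OF ind xA] by simp
  have eqB: "representation (A \<union> B) x = representation B x"
    using representation_extend[OF ind xB] by simp
  have "representation A x b = 0" for b
  proof (rule ccontr)
    assume "representation A x b \<noteq> 0"
    then have "b \<in> A" "b \<in> B"
      using representation_ne_zero eqA eqB by metis+
    then show False using disj by blast
  qed
  moreover have "independent A"
    using ind by (rule independent_mono) blast
  ultimately show ?thesis
    using sum_nonzero_representation_eq[OF _ xA] by simp
qed

text \<open>The ambient spaces may be infinite-dimensional, so finiteness of \<open>S\<close> is
  itself a conclusion, drawn from that of kernel and image. A basis of the kernel is extended to one
  of \<open>S\<close>; \<open>f\<close> is injective on the span of the added vectors
  \<open>D\<close>, whose images therefore form a basis of the image.\<close>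

lemma (in vector_space_pair) rank_nullity_on:
  assumes lin: "Vector_Spaces.linear s1 s2 f" and S: "vs1.subspace S"
    and N: "finite N" "{x \<in> S. f x = 0} \<subseteq> vs1.span N"
    and C: "finite C" "f ` S \<subseteq> vs2.span C"
  shows "\<exists>B. finite B \<and> vs1.span B = S"
    and "vs1.dim S = vs1.dim {x \<in> S. f x = 0} + vs2.dim (f ` S)"
proof -
  let ?K = "{x \<in> S. f x = 0}"
  obtain K where K: "K \<subseteq> ?K" "vs1.independent K" "?K \<subseteq> vs1.span K" "card K = vs1.dim ?K"
    using vs1.basis_exists by blast
  have finK: "finite K"
    using vs1.independent_span_bound[OF N(1) K(2)] K(1) N(2) by blast
  have "K \<subseteq> S" using K(1) by blast
  then obtain B where B: "K \<subseteq> B" "B \<subseteq> S" "vs1.independent B" "S \<subseteq> vs1.span B"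
    using vs1.maximal_independent_subset_extend[OF _ K(2), of S] by blast
  have spB: "vs1.span B = S"
    using B S vs1.span_subspace by blast
  define D where "D = B - K"
  have BKD: "B = K \<union> D" "K \<inter> D = {}" using B(1) by (auto simp: D_def)
  have DS: "vs1.span D \<subseteq> S"
    using vs1.span_mono[of D B] spB D_def by auto
  have inj: "inj_on f (vs1.span D)"
  proof -
    have "x = 0" if x: "x \<in> vs1.span D" "f x = 0" for x
    proof -
      have "x \<in> vs1.span K" using x DS K(3) by blast
      then show ?thesis
        using vs1.independent_Un_span_Int[of K D x] B(3) BKD x(1) by simp
    qed
    then show ?thesis
      by (subst linear_inj_on_iff_eq_0[OF lin]) auto
  qed
  have indD: "vs1.independent D" using B(3) by (rule vs1.independent_mono) (simp add: D_def)
  have indfD: "vs2.independent (f ` D)"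
    using linear_independent_injective_image[OF lin indD inj] .
  have "f ` D \<subseteq> vs2.span C" using C(2) DS vs1.span_superset by blast
  then have "finite (f ` D)"
    using vs2.independent_span_bound[OF C(1) indfD] by blast
  moreover have injD: "inj_on f D"
    using inj vs1.span_superset by (rule inj_on_subset)
  ultimately have finD: "finite D" using finite_imageD by blast
  have "f ` S \<subseteq> vs2.span (f ` D)"
  proof
    fix y assume "y \<in> f ` S"
    then obtain x where x: "x \<in> S" "y = f x" by blast
    then have "x \<in> vs1.span (K \<union> D)" using spB BKD by simp
    then obtain k d where kd: "x = k + d" "k \<in> vs1.span K" "d \<in> vs1.span D"
      unfolding vs1.span_Un by blast
    have "f k = 0"
      using linear_eq_0_on_span[OF lin _ kd(2)] K(1) by blast
    then have "y = f d" using x kd linear_add[OF lin] by simp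
    then show "y \<in> vs2.span (f ` D)"
      using kd(3) linear_span_image[OF lin] by blast
  qed
  moreover have "f ` D \<subseteq> f ` S" using DS vs1.span_superset by blast
  ultimately have "card (f ` D) = vs2.dim (f ` S)"
    using indfD by (intro vs2.basis_card_eq_dim) auto
  then have dimf: "vs2.dim (f ` S) = card D" using card_image[OF injD] by simp
  show "\<exists>B. finite B \<and> vs1.span B = S"
    using finK finD BKD spB by (intro exI[of _ B]) auto
  have "card B = vs1.dim S" using B by (intro vs1.basis_card_eq_dim) auto
  moreover have "card B = card K + card D"
    using BKD finK finD by (simp add: card_Un_disjoint)
  ultimately show "vs1.dim S = vs1.dim ?K + vs2.dim (f ` S)"
    using dimf K(4) by simp
qed

text \<open>A model of the quotient map by \<open>Z\<close> inside the space itself: a basis of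
  \<open>Z\<close> is extended to the whole space, and \<open>\<pi>\<close> kills the former and
  fixes the added vectors.\<close>

lemma (in vector_space) exists_linear_with_kernel:
  assumes Z: "subspace Z"
  shows "\<exists>\<pi>. Vector_Spaces.linear scale scale \<pi> \<and> {x. \<pi> x = 0} = Z"
proof -
  interpret pair: vector_space_pair scale scale ..
  obtain C where C: "C \<subseteq> Z" "independent C" "Z \<subseteq> span C"
    using basis_exists[of Z] by metis
  obtain B where B: "C \<subseteq> B" "independent B" "UNIV \<subseteq> span B"
    using maximal_independent_subset_extend[OF subset_UNIV C(2)] by metis
  have spC: "span C = Z" using C Z span_subspace by blast
  define \<pi> where "\<pi> = pair.construct B (\<lambda>b. if b \<in> C then 0 else b)"
  have lin: "Vector_Spaces.linear scale scale \<pi>"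
    unfolding \<pi>_def by (rule pair.linear_construct[OF B(2)])
  have piB: "\<pi> b = (if b \<in> C then 0 else b)" if "b \<in> B" for b
    unfolding \<pi>_def using pair.construct_basis[OF B(2) that] .
  have piC: "\<pi> x = 0" if "x \<in> span C" for x
    by (rule pair.linear_eq_0_on_span[OF lin _ that]) (use piB B(1) in auto)
  have piD: "\<pi> x = x" if "x \<in> span (B - C)" for x
    by (rule pair.linear_eq_on[OF lin linear_ident that]) (use piB in auto)
  have "\<pi> x = 0 \<longleftrightarrow> x \<in> Z" for x
  proof
    assume "x \<in> Z" then show "\<pi> x = 0" using piC spC by simp
  next
    assume 0: "\<pi> x = 0"
    have "x \<in> span (C \<union> (B - C))" using B(1,3) by (auto simp: Un_absorb1)
    then obtain k d where kd: "x = k + d" "k \<in> span C" "d \<in> span (B - C)"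
      unfolding span_Un by blast
    then have "d = 0" using 0 pair.linear_add[OF lin] piC piD by simp
    then show "x \<in> Z" using kd spC by simp
  qed
  then show ?thesis using lin by blast
qed

context complex_vector_space
begin

text \<open>This gives the definite description in \<open>quotient_dim\<close> its meaning. The
  scalar condition makes a map with kernel \<open>Z\<close> injective on the span of the
  representatives, so their images form a basis of the image of \<open>Y\<close>, whose dimension
  does not depend on the choice.\<close>

lemma card_quotient_basis_unique:
  assumes Z: "subspace Z" and B: "quotient_basis Y Z B" and B': "quotient_basis Y Z B'"
  shows "card B = card B'"
proof -
  interpret pair: vector_space_pair scale scale ..
  obtain \<pi> where lin: "Vector_Spaces.linear scale scale \<pi>" and ker: "{x. \<pi> x = 0} = Z"
    using exists_linear_with_kernel[OF Z] by blast
  have "card C = dim (\<pi> ` Y)" if C: "quotient_basis Y Z C" for C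
  proof -
    have fin: "finite C" and CY: "C \<subseteq> Y" and sp: "span (Z \<union> C) = Y"
      and scal: "\<And>c. (\<Sum>b\<in>C. scale (c b) b) \<in> Z \<Longrightarrow> \<forall>b\<in>C. c b = 0"
      using C unfolding quotient_basis_def by auto
    have ind: "independent C"
      by (rule independent_if_scalars_zero[OF fin])
         (use scal subspace_0[OF Z] in auto)
    have inj: "inj_on \<pi> (span C)"
    proof -
      have "x = 0" if x: "x \<in> span C" "\<pi> x = 0" for x
      proof -
        obtain c where c: "x = (\<Sum>b\<in>C. scale (c b) b)"
          using x(1) unfolding span_finite[OF fin] by blast
        then have "\<forall>b\<in>C. c b = 0" using scal x(2) ker by blast
        then show ?thesis using c by simp
      qed
      then show ?thesis by (subst pair.linear_inj_on_iff_eq_0[OF lin]) auto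
    qed
    have ind': "independent (\<pi> ` C)"
      using pair.linear_independent_injective_image[OF lin ind inj] .
    have "\<pi> ` Y = span (\<pi> ` (Z \<union> C))"
      using sp pair.linear_span_image[OF lin] by metis
    moreover have "\<pi> ` (Z \<union> C) \<subseteq> insert 0 (\<pi> ` C)" using ker by auto
    ultimately have "\<pi> ` Y \<subseteq> span (\<pi> ` C)"
      using span_mono[of "\<pi> ` (Z \<union> C)" "insert 0 (\<pi> ` C)"] by simp
    then have "card (\<pi> ` C) = dim (\<pi> ` Y)"
      using CY ind' by (intro basis_card_eq_dim) auto
    then show ?thesis
      using card_image[OF inj_on_subset[OF inj span_superset]] by simp
  qed
  then show ?thesis using B B' by simp
qed

text \<open>The second isomorphism theorem: Y/Z is Y0/(Z \<inter> Y0), so vectors completing a basis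
  of \<open>Z \<inter> Y0\<close> to one of \<open>Y0\<close> represent a basis of the quotient. A
  cokernel thus becomes a count inside one finite-dimensional space.\<close>

lemma quotient_dim_sum:
  assumes Z: "subspace Z" and Y0: "subspace Y0" "finite F" "Y0 \<subseteq> span F"
    and Y: "Y = {z + y |z y. z \<in> Z \<and> y \<in> Y0}"
  shows "\<exists>B. quotient_basis Y Z B"
    and "dim Y0 = dim (Z \<inter> Y0) + quotient_dim Y Z"
proof -
  obtain C where C: "C \<subseteq> Z \<inter> Y0" "independent C" "Z \<inter> Y0 \<subseteq> span C" "card C = dim (Z \<inter> Y0)"
    using basis_exists by blast
  have "C \<subseteq> Y0" using C(1) by blast
  then obtain B where B: "C \<subseteq> B" "B \<subseteq> Y0" "independent B" "Y0 \<subseteq> span B"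
    using maximal_independent_subset_extend[OF _ C(2)] by blast
  have finB: "finite B"
    using independent_span_bound[OF Y0(2) B(3)] B(2) Y0(3) by blast
  define D where "D = B - C"
  have BCD: "B = C \<union> D" "C \<inter> D = {}" using B(1) by (auto simp: D_def)
  have finD: "finite D" using finB D_def by simp
  have indD: "independent D" using B(3) by (rule independent_mono) (simp add: D_def)
  have DY0: "span D \<subseteq> Y0"
    using B(2) Y0(1) by (intro span_minimal) (auto simp: D_def)
  have spB: "span (Z \<union> D) = Y"
  proof
    show "span (Z \<union> D) \<subseteq> Y"
    proof
      fix x assume "x \<in> span (Z \<union> D)"
      then obtain z d where "x = z + d" "z \<in> span Z" "d \<in> span D"
        unfolding span_Un by blast
      moreover have "span Z = Z" using Z by simp
      ultimately show "x \<in> Y" unfolding Y using DY0 by blast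
    qed
    show "Y \<subseteq> span (Z \<union> D)"
    proof
      fix x assume "x \<in> Y"
      then obtain z y where x: "x = z + y" "z \<in> Z" "y \<in> Y0" unfolding Y by blast
      have "B \<subseteq> Z \<union> D" using C(1) BCD by blast
      then have "y \<in> span (Z \<union> D)" using x(3) B(4) span_mono by blast
      then show "x \<in> span (Z \<union> D)"
        using x by (auto intro: span_add span_base)
    qed
  qed
  have "\<forall>b\<in>D. c b = 0" if c: "(\<Sum>b\<in>D. scale (c b) b) \<in> Z" for c
  proof -
    have in_D: "(\<Sum>b\<in>D. scale (c b) b) \<in> span D"
      by (intro span_sum span_scale span_base)
    then have "(\<Sum>b\<in>D. scale (c b) b) \<in> span C" using c C(3) DY0 by blast
    then have "(\<Sum>b\<in>D. scale (c b) b) = 0"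
      using independent_Un_span_Int[of C D] B(3) BCD in_D by simp
    then show ?thesis
      using independentD[OF indD finD subset_refl] by blast
  qed
  moreover have "D \<subseteq> Y"
    using spB span_superset by blast
  ultimately have qb: "quotient_basis Y Z D"
    unfolding quotient_basis_def using finD spB by blast
  then show "\<exists>B. quotient_basis Y Z B" by blast
  have "quotient_dim Y Z = card D"
    unfolding quotient_dim_def
  proof (rule the_equality)
    show "\<exists>B. quotient_basis Y Z B \<and> card B = card D" using qb by blast
  next
    fix n assume "\<exists>B. quotient_basis Y Z B \<and> card B = n"
    then obtain B' where "quotient_basis Y Z B'" "card B' = n" by blast
    then show "n = card D" using card_quotient_basis_unique[OF Z _ qb] by simp
  qed
  moreover have "card B = dim Y0" using B by (intro basis_card_eq_dim) auto
  moreover have "card B = card C + card D"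
    using BCD finB by (simp add: card_Un_disjoint)
  ultimately show "dim Y0 = dim (Z \<inter> Y0) + quotient_dim Y Z"
    using C(4) by simp
qed

text \<open>Operators on \<open>H 0\<close> built from functionals are linear only on that subspace,
  while \<open>rank_nullity_on\<close> takes maps that are linear on the ambient space.\<close>

lemma linear_on_extend:
  assumes V: "subspace V" and f: "linear_on V f"
  shows "\<exists>g. Vector_Spaces.linear scale scale g \<and> (\<forall>x\<in>V. g x = f x)"
proof -
  interpret pair: vector_space_pair scale scale ..
  obtain B where B: "B \<subseteq> V" "independent B" "V \<subseteq> span B"
    using basis_exists[of V] by metis
  define g where "g = pair.construct B f"
  have lin: "Vector_Spaces.linear scale scale g"
    unfolding g_def by (rule pair.linear_construct[OF B(2)])
  have f0: "f 0 = 0"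
  proof -
    have "f (scale 0 0) = scale 0 (f 0)"
      using f subspace_0[OF V] unfolding linear_on_def by blast
    then show ?thesis by simp
  qed
  have "x \<in> V \<and> g x = f x" if "x \<in> span B" for x
    using that
  proof (induction rule: span_induct_alt)
    case base
    then show ?case using f0 pair.linear_0[OF lin] subspace_0[OF V] by simp
  next
    case (step c b y)
    have b: "b \<in> V" "g b = f b" using step(1) B pair.construct_basis[OF B(2)] g_def by auto
    then have cb: "scale c b \<in> V" using V by (simp add: subspace_scale)
    have "f (scale c b + y) = scale c (f b) + f y"
      using f b(1) cb step(2) unfolding linear_on_def by simp
    then show ?case
      using b cb step(2) subspace_add[OF V]
      by (simp add: pair.linear_add[OF lin] pair.linear_scale[OF lin])
  qed
  then show ?thesis using lin B(3) by (intro exI[of _ g]) auto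
qed

lemma linear_on_sum:
  assumes W: "subspace W" and A: "linear_on W A" and f: "\<And>i. i \<in> I \<Longrightarrow> f i \<in> W"
  shows "A (\<Sum>i\<in>I. scale (c i) (f i)) = (\<Sum>i\<in>I. scale (c i) (A (f i)))"
proof -
  have add: "\<And>x y. x \<in> W \<Longrightarrow> y \<in> W \<Longrightarrow> A (x + y) = A x + A y"
    and sc: "\<And>c x. x \<in> W \<Longrightarrow> A (scale c x) = scale c (A x)"
    using A unfolding linear_on_def by auto
  have zero: "A 0 = 0" using sc[OF subspace_0[OF W], of 0] by simp
  show ?thesis
    using f
    by (induction I rule: infinite_finite_induct)
       (simp_all add: zero add sc subspace_scale[OF W] subspace_sum[OF W])
qed

end

section \<open>Positive Hermitian forms\<close>

locale positive_form_on = complex_vector_space scale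
  for scale :: "complex \<Rightarrow> 'a::ab_group_add \<Rightarrow> 'a" +
  fixes V :: "'a set" and form :: "'a \<Rightarrow> 'a \<Rightarrow> complex"
  assumes carrier_subspace: "subspace V"
    and form_add_left: "\<lbrakk>x \<in> V; y \<in> V; z \<in> V\<rbrakk> \<Longrightarrow> form (x + y) z = form x z + form y z"
    and form_scale_left: "\<lbrakk>x \<in> V; y \<in> V\<rbrakk> \<Longrightarrow> form (scale c x) y = c * form x y"
    and form_cnj: "\<lbrakk>x \<in> V; y \<in> V\<rbrakk> \<Longrightarrow> form y x = cnj (form x y)"
    and form_nonneg: "x \<in> V \<Longrightarrow> Re (form x x) \<ge> 0"
begin

lemma carrier_closed [simp]:
  shows "0 \<in> V"
    and "\<lbrakk>x \<in> V; y \<in> V\<rbrakk> \<Longrightarrow> x + y \<in> V"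
    and "\<lbrakk>x \<in> V; y \<in> V\<rbrakk> \<Longrightarrow> x - y \<in> V"
    and "x \<in> V \<Longrightarrow> scale c x \<in> V"
    and "x \<in> V \<Longrightarrow> - x \<in> V"
  by (simp_all add: carrier_subspace subspace_0 subspace_add subspace_diff subspace_scale subspace_neg)

lemma carrier_sum [simp]: "(\<And>i. i \<in> I \<Longrightarrow> f i \<in> V) \<Longrightarrow> sum f I \<in> V"
  by (rule subspace_sum[OF carrier_subspace])

lemma form_add_right: "\<lbrakk>x \<in> V; y \<in> V; z \<in> V\<rbrakk> \<Longrightarrow> form x (y + z) = form x y + form x z"
  using form_cnj[of "y + z" x] form_cnj[of y x] form_cnj[of z x] form_add_left by simp

lemma form_scale_right: "\<lbrakk>x \<in> V; y \<in> V\<rbrakk> \<Longrightarrow> form x (scale c y) = cnj c * form x y"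
  using form_cnj[of "scale c y" x] form_cnj[of y x] form_scale_left by simp

lemma form_zero_left [simp]: "x \<in> V \<Longrightarrow> form 0 x = 0"
  using form_scale_left[of 0 x 0] by simp

lemma form_zero_right [simp]: "x \<in> V \<Longrightarrow> form x 0 = 0"
  using form_scale_right[of x 0 0] by simp

lemma form_diff_left: "\<lbrakk>x \<in> V; y \<in> V; z \<in> V\<rbrakk> \<Longrightarrow> form (x - y) z = form x z - form y z"
  using form_add_left[of "x - y" y z] by simp

lemma form_diff_right: "\<lbrakk>x \<in> V; y \<in> V; z \<in> V\<rbrakk> \<Longrightarrow> form x (y - z) = form x y - form x z"
  using form_add_right[of x "y - z" z] by simp

lemma form_sum_left:
  assumes "\<And>i. i \<in> I \<Longrightarrow> f i \<in> V" "y \<in> V"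
  shows "form (sum f I) y = (\<Sum>i\<in>I. form (f i) y)"
  using assms by (induction I rule: infinite_finite_induct) (simp_all add: form_add_left)

lemma form_sum_right:
  assumes "\<And>i. i \<in> I \<Longrightarrow> f i \<in> V" "y \<in> V"
  shows "form y (sum f I) = (\<Sum>i\<in>I. form y (f i))"
  using assms by (induction I rule: infinite_finite_induct) (simp_all add: form_add_right)

lemma Im_form_self: "x \<in> V \<Longrightarrow> Im (form x x) = 0"
  using form_cnj[of x x] by (metis cnj.sel(2) equal_neg_zero)

lemma nrm_nonneg [simp]: "x \<in> V \<Longrightarrow> 0 \<le> nrm form x"
  by (simp add: nrm_def form_nonneg)

lemma nrm_power2: "x \<in> V \<Longrightarrow> (nrm form x)\<^sup>2 = Re (form x x)"
  by (simp add: nrm_def form_nonneg)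

lemma form_self: "x \<in> V \<Longrightarrow> form x x = of_real ((nrm form x)\<^sup>2)"
  by (simp add: nrm_power2 complex_eq_iff Im_form_self)

lemma nrm_zero [simp]: "nrm form 0 = 0"
  by (simp add: nrm_def)

text \<open>The coefficient is a real multiple of \<open>form x y\<close>, so the two cross terms
  are real and equal and the result is a real quadratic polynomial in \<open>t\<close>.\<close>

lemma nrm_power2_diff_scale:
  assumes "x \<in> V" "y \<in> V"
  shows "(nrm form (x - scale (of_real t * form x y) y))\<^sup>2 =
    (nrm form x)\<^sup>2 - 2 * t * (cmod (form x y))\<^sup>2 + t\<^sup>2 * (cmod (form x y))\<^sup>2 * (nrm form y)\<^sup>2"
proof -
  let ?c = "form x y" and ?z = "of_real t * form x y"
  have cc: "?c * cnj ?c = of_real ((cmod ?c)\<^sup>2)" by (rule complex_norm_square[symmetric])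
  have "form (x - scale ?z y) (x - scale ?z y) =
      form x x - cnj ?z * ?c - ?z * form y x + ?z * cnj ?z * form y y"
    using assms
    by (simp add: form_diff_left form_diff_right form_scale_left form_scale_right algebra_simps)
  also have "\<dots> = form x x - 2 * of_real t * (?c * cnj ?c) + (of_real t)\<^sup>2 * (?c * cnj ?c) * form y y"
    using form_cnj[OF assms] by (simp add: algebra_simps power2_eq_square)
  also have "\<dots> = of_real ((nrm form x)\<^sup>2 - 2 * t * (cmod ?c)\<^sup>2 + t\<^sup>2 * (cmod ?c)\<^sup>2 * (nrm form y)\<^sup>2)"
    unfolding cc using assms by (simp add: form_self)
  finally show ?thesis
    using assms by (simp add: nrm_power2[of "x - scale ?z y"])
qed

lemma form_Cauchy_Schwarz:
  assumes "x \<in> V" "y \<in> V"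
  shows "cmod (form x y) \<le> nrm form x * nrm form y"
proof -
  let ?a = "(nrm form x)\<^sup>2" and ?b = "(nrm form y)\<^sup>2" and ?d = "(cmod (form x y))\<^sup>2"
  have pos: "0 \<le> ?a - 2 * t * ?d + t\<^sup>2 * ?d * ?b" for t
    using nrm_power2_diff_scale[OF assms, of t] by (metis zero_le_power2)
  have "?d \<le> ?a * ?b"
  proof (cases "?b = 0")
    case True
    have "?d = 0"
    proof (rule ccontr)
      assume "?d \<noteq> 0"
      \<comment> \<open>For a null vector \<open>y\<close> only the linear part of the polynomial
        remains; at this \<open>t\<close> it equals -1.\<close>
      then show False using pos[of "(?a + 1) / (2 * ?d)"] True by (simp add: field_simps)
    qed
    then show ?thesis using True by simp
  next
    case False
    then have b: "?b > 0" by simp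
    \<comment> \<open>The minimum of the quadratic polynomial is attained at t = 1/b.\<close>
    have "0 \<le> ?a - ?d / ?b"
    proof -
      have "a - 2 * (1 / r) * d + (1 / r)\<^sup>2 * d * r = a - d / r" if "r > 0" for a d r :: real
        using that by (simp add: field_simps power2_eq_square)
      from this[OF b, of ?a ?d] show ?thesis using pos[of "1 / ?b"] by linarith
    qed
    then show ?thesis using b by (simp add: field_simps)
  qed
  then have "(cmod (form x y))\<^sup>2 \<le> (nrm form x * nrm form y)\<^sup>2"
    by (simp add: power_mult_distrib)
  then show ?thesis using assms by (simp add: power2_le_iff_abs_le)
qed

lemma nrm_triangle:
  assumes "x \<in> V" "y \<in> V"
  shows "nrm form (x + y) \<le> nrm form x + nrm form y"
proof -
  have "(nrm form (x + y))\<^sup>2 = Re (form x x) + Re (form y y) + 2 * Re (form x y)"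
    using assms form_cnj[OF assms] by (simp add: nrm_power2 form_add_left form_add_right)
  also have "\<dots> \<le> (nrm form x)\<^sup>2 + (nrm form y)\<^sup>2 + 2 * (nrm form x * nrm form y)"
    using form_Cauchy_Schwarz[OF assms] complex_Re_le_cmod[of "form x y"] assms
    by (simp add: nrm_power2)
  also have "\<dots> = (nrm form x + nrm form y)\<^sup>2" by (simp add: power2_sum)
  finally show ?thesis using assms by (meson add_nonneg_nonneg nrm_nonneg power2_le_imp_le)
qed

lemma nrm_scale:
  assumes "x \<in> V"
  shows "nrm form (scale c x) = cmod c * nrm form x"
proof -
  have "form (scale c x) (scale c x) = (c * cnj c) * form x x"
    using assms by (simp add: form_scale_left form_scale_right)
  also have "\<dots> = of_real ((cmod c * nrm form x)\<^sup>2)"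
    using assms by (simp add: form_self complex_norm_square[symmetric] power_mult_distrib)
  finally have "Re (form (scale c x) (scale c x)) = (cmod c * nrm form x)\<^sup>2" by simp
  then show ?thesis using assms by (simp add: nrm_def[of form "scale c x"])
qed

lemma nrm_minus: "x \<in> V \<Longrightarrow> nrm form (- x) = nrm form x"
  using nrm_scale[of x "-1"] by simp

lemma nrm_diff_commute: "\<lbrakk>x \<in> V; y \<in> V\<rbrakk> \<Longrightarrow> nrm form (x - y) = nrm form (y - x)"
  using nrm_minus[of "x - y"] by simp

lemma nrm_triangle_diff:
  "\<lbrakk>x \<in> V; y \<in> V\<rbrakk> \<Longrightarrow> nrm form (x - y) \<le> nrm form x + nrm form y"
  using nrm_triangle[of x "- y"] nrm_minus[of y] by simp

lemma nrm_triangle_sub: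
  "\<lbrakk>x \<in> V; y \<in> V\<rbrakk> \<Longrightarrow> nrm form x \<le> nrm form y + nrm form (x - y)"
  using nrm_triangle[of y "x - y"] by simp

lemma nrm_sum_le:
  assumes "\<And>i. i \<in> I \<Longrightarrow> f i \<in> V"
  shows "nrm form (sum f I) \<le> (\<Sum>i\<in>I. nrm form (f i))"
  using assms
proof (induction I rule: infinite_finite_induct)
  case (insert i I)
  then show ?case using nrm_triangle[of "f i" "sum f I"] by simp
qed simp_all

section \<open>Convergence in the seminorm of a form\<close>

lemma converges_in_add:
  assumes "converges_in V form X x" "converges_in V form Y y"
  shows "converges_in V form (\<lambda>n. X n + Y n) (x + y)"
proof -
  have V: "\<And>n. X n \<in> V" "x \<in> V" "\<And>n. Y n \<in> V" "y \<in> V"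
    and lim: "(\<lambda>n. nrm form (X n - x)) \<longlonglongrightarrow> 0" "(\<lambda>n. nrm form (Y n - y)) \<longlonglongrightarrow> 0"
    using assms by (auto simp: converges_in_def)
  have "(\<lambda>n. nrm form (X n + Y n - (x + y))) \<longlonglongrightarrow> 0"
  proof (rule tendsto_sandwich[OF _ _ tendsto_const])
    show "(\<lambda>n. nrm form (X n - x) + nrm form (Y n - y)) \<longlonglongrightarrow> 0"
      using tendsto_add[OF lim] by simp
    show "\<forall>\<^sub>F n in sequentially. nrm form (X n + Y n - (x + y)) \<le>
        nrm form (X n - x) + nrm form (Y n - y)"
      using V nrm_triangle[of "X _ - x" "Y _ - y"] by (simp add: add_diff_add)
  qed (simp add: V)
  then show ?thesis using V by (simp add: converges_in_def)
qed

lemma converges_in_const: "x \<in> V \<Longrightarrow> converges_in V form (\<lambda>n. x) x"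
  by (simp add: converges_in_def)

lemma converges_in_bounded_image:
  assumes X: "converges_in V form X x"
    and T: "\<And>x. x \<in> V \<Longrightarrow> T x \<in> V" "\<And>x y. x \<in> V \<Longrightarrow> y \<in> V \<Longrightarrow> T (x - y) = T x - T y"
    and C: "\<And>x. x \<in> V \<Longrightarrow> nrm form (T x) \<le> C * nrm form x"
  shows "converges_in V form (\<lambda>n. T (X n)) (T x)"
proof -
  have V: "\<And>n. X n \<in> V" "x \<in> V" and lim: "(\<lambda>n. nrm form (X n - x)) \<longlonglongrightarrow> 0"
    using X by (auto simp: converges_in_def)
  have "(\<lambda>n. nrm form (T (X n - x))) \<longlonglongrightarrow> 0"
  proof (rule tendsto_sandwich[OF _ _ tendsto_const])
    show "(\<lambda>n. C * nrm form (X n - x)) \<longlonglongrightarrow> 0"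
      using tendsto_mult_right_zero[OF lim] by simp
    show "\<forall>\<^sub>F n in sequentially. nrm form (T (X n - x)) \<le> C * nrm form (X n - x)"
      using V by (intro always_eventually allI C) simp
  qed (simp add: V T(1))
  then show ?thesis using V T by (simp add: converges_in_def)
qed

end

section \<open>Orthonormal systems and the Neumann series\<close>

sublocale hilbert_space_on \<subseteq> positive_form_on scale V ip
proof
  fix x assume x: "x \<in> V"
  have "ip 0 0 = 0"
    using ip_scale[of 0 0 0] subspace_0[OF subspace_V] by simp
  then show "0 \<le> Re (ip x x)" using ip_pos[OF x] by (cases "x = 0") auto
qed (rule subspace_V ip_add ip_scale ip_cnj; assumption)+

context hilbert_space_on
begin

lemma nrm_eq_0_iff [simp]: "x \<in> V \<Longrightarrow> nrm ip x = 0 \<longleftrightarrow> x = 0"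
  using ip_pos[of x] by (cases "x = 0") (simp_all add: nrm_def)

lemma nrm_le_0D: "\<lbrakk>x \<in> V; nrm ip x \<le> 0\<rbrakk> \<Longrightarrow> x = 0"
  using nrm_nonneg[of x] nrm_eq_0_iff[of x] by linarith

definition orthonormal :: "'a set \<Rightarrow> bool" where
  "orthonormal E \<longleftrightarrow> E \<subseteq> V \<and> (\<forall>e\<in>E. \<forall>f\<in>E. ip e f = (if e = f then 1 else 0))"

lemma orthonormal_basis_iff:
  "orthonormal_basis E \<longleftrightarrow> orthonormal E \<and> dense_in V ip (span E)"
  by (auto simp: orthonormal_basis_def orthonormal_def)

lemma orthonormal_in: "orthonormal E \<Longrightarrow> e \<in> E \<Longrightarrow> e \<in> V"
  by (auto simp: orthonormal_def)

lemma orthonormal_ip: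
  "\<lbrakk>orthonormal E; e \<in> E; f \<in> E\<rbrakk> \<Longrightarrow> ip e f = (if e = f then 1 else 0)"
  by (simp add: orthonormal_def)

lemma orthonormal_subset: "orthonormal E \<Longrightarrow> F \<subseteq> E \<Longrightarrow> orthonormal F"
  unfolding orthonormal_def by blast

lemma ip_orthonormal_sum:
  assumes E: "orthonormal E" and e: "e \<in> E" and fin: "finite E"
  shows "ip (\<Sum>f\<in>E. scale (c f) f) e = c e"
proof -
  have "ip (\<Sum>f\<in>E. scale (c f) f) e = (\<Sum>f\<in>E. c f * ip f e)"
    using orthonormal_in[OF E] e by (simp add: form_sum_left form_scale_left)
  also have "\<dots> = (\<Sum>f\<in>E. if f = e then c f else 0)"
    using E e by (intro sum.cong) (auto simp: orthonormal_ip)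
  finally show ?thesis using e fin by simp
qed

lemma nrm_power2_orthonormal_sum:
  assumes E: "orthonormal E" and fin: "finite E"
  shows "(nrm ip (\<Sum>e\<in>E. scale (c e) e))\<^sup>2 = (\<Sum>e\<in>E. (cmod (c e))\<^sup>2)"
proof -
  let ?s = "\<Sum>e\<in>E. scale (c e) e"
  have V: "?s \<in> V" using orthonormal_in[OF E] by simp
  have "ip ?s ?s = (\<Sum>e\<in>E. cnj (c e) * ip ?s e)"
    using orthonormal_in[OF E] V by (simp add: form_sum_right form_scale_right)
  also have "\<dots> = (\<Sum>e\<in>E. of_real ((cmod (c e))\<^sup>2))"
  proof (rule sum.cong[OF refl])
    fix e assume "e \<in> E"
    then have "ip ?s e = c e" using E fin by (simp add: ip_orthonormal_sum)
    then show "cnj (c e) * ip ?s e = of_real ((cmod (c e))\<^sup>2)"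
      by (simp only: complex_norm_square mult.commute)
  qed
  finally show ?thesis using V by (simp add: nrm_power2)
qed

definition proj_sum :: "'a set \<Rightarrow> 'a \<Rightarrow> 'a" where
  "proj_sum E x = (\<Sum>e\<in>E. scale (ip x e) e)"

lemma proj_sum_in: "orthonormal E \<Longrightarrow> proj_sum E x \<in> V"
  unfolding proj_sum_def using orthonormal_in by auto

text \<open>Pythagoras, as \<open>x - proj_sum E x\<close> is orthogonal to the span of
  \<open>E\<close>. With \<open>c\<close> zero it yields Bessel's inequality, with general
  \<open>c\<close> that \<open>proj_sum E x\<close> is the best approximation.\<close>

lemma nrm_power2_orthogonal_decomp:
  assumes E: "orthonormal E" and fin: "finite E" and x: "x \<in> V"
  shows "(nrm ip (x - (\<Sum>e\<in>E. scale (c e) e)))\<^sup>2 =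
    (nrm ip (x - proj_sum E x))\<^sup>2 + (\<Sum>e\<in>E. (cmod (ip x e - c e))\<^sup>2)"
proof -
  let ?r = "x - proj_sum E x" and ?d = "\<Sum>e\<in>E. scale (ip x e - c e) e"
  have V: "?r \<in> V" "?d \<in> V" using x proj_sum_in[OF E] orthonormal_in[OF E] by auto
  have r: "ip ?r e = 0" if "e \<in> E" for e
    using that x proj_sum_in[OF E, of x] orthonormal_in[OF E]
      ip_orthonormal_sum[OF E that fin, of "\<lambda>e. ip x e"]
    by (simp add: form_diff_left proj_sum_def)
  have "ip ?r ?d = 0"
    using V r orthonormal_in[OF E] by (simp add: form_sum_right form_scale_right)
  then have "ip (?r + ?d) (?r + ?d) = ip ?r ?r + ip ?d ?d"
    using V form_cnj[of ?r ?d] by (simp add: form_add_left form_add_right)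
  then have "(nrm ip (?r + ?d))\<^sup>2 = (nrm ip ?r)\<^sup>2 + (nrm ip ?d)\<^sup>2"
    using V by (simp add: nrm_power2)
  moreover have "?r + ?d = x - (\<Sum>e\<in>E. scale (c e) e)"
    by (simp add: proj_sum_def scale_left_diff_distrib sum_subtractf)
  ultimately show ?thesis by (simp add: nrm_power2_orthonormal_sum[OF E fin])
qed

lemma Bessel_inequality:
  assumes "orthonormal E" "finite E" "x \<in> V"
  shows "(\<Sum>e\<in>E. (cmod (ip x e))\<^sup>2) \<le> (nrm ip x)\<^sup>2"
  using nrm_power2_orthogonal_decomp[OF assms, of "\<lambda>_. 0"] by simp

lemma proj_sum_id:
  assumes E: "orthonormal E" and fin: "finite E" and x: "x \<in> span E"
  shows "proj_sum E x = x"
proof -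
  obtain c where c: "x = (\<Sum>e\<in>E. scale (c e) e)"
    using x unfolding span_finite[OF fin] by blast
  show ?thesis
    unfolding proj_sum_def
    by (subst (2) c, rule sum.cong) (simp_all add: c ip_orthonormal_sum[OF E _ fin])
qed

text \<open>Density yields one good approximation in the span of a finite \<open>F0\<close>; best
  approximation transfers it to every larger finite \<open>F\<close>, which is the form that
  unordered sums require.\<close>

lemma Fourier_approximation:
  assumes E: "orthonormal_basis E" and x: "x \<in> V" and e: "\<epsilon> > 0"
  shows "\<exists>F0. finite F0 \<and> F0 \<subseteq> E \<and>
    (\<forall>F. finite F \<and> F0 \<subseteq> F \<and> F \<subseteq> E \<longrightarrow> nrm ip (x - proj_sum F x) < \<epsilon>)"
proof -
  have on: "orthonormal E" and dense: "dense_in V ip (span E)"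
    using E by (auto simp: orthonormal_basis_iff)
  obtain y where y: "y \<in> span E" "nrm ip (x - y) < \<epsilon>"
    using dense x e unfolding dense_in_def by blast
  obtain F0 where F0: "finite F0" "F0 \<subseteq> E" "y \<in> span F0"
    using y(1) by (force simp: span_explicit intro: span_sum span_scale span_base)
  have "nrm ip (x - proj_sum F x) < \<epsilon>" if F: "finite F" "F0 \<subseteq> F" "F \<subseteq> E" for F
  proof -
    have onF: "orthonormal F" using on F(3) by (rule orthonormal_subset)
    have "y \<in> span F" using F0(3) F(2) span_mono by blast
    then obtain c where c: "y = (\<Sum>e\<in>F. scale (c e) e)"
      unfolding span_finite[OF F(1)] by blast
    have "(nrm ip (x - proj_sum F x))\<^sup>2 \<le> (nrm ip (x - y))\<^sup>2"
      unfolding c nrm_power2_orthogonal_decomp[OF onF F(1) x]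
      by (simp add: sum_nonneg)
    moreover have "y \<in> V" using c onF orthonormal_in by simp
    ultimately have "nrm ip (x - proj_sum F x) \<le> nrm ip (x - y)"
      using x proj_sum_in[OF onF] by (simp add: power2_le_iff_abs_le)
    then show ?thesis using y(2) by simp
  qed
  then show ?thesis using F0 by blast
qed

lemma exists_orthonormal_of_finite:
  assumes "finite B" "B \<subseteq> V"
  shows "\<exists>E. finite E \<and> orthonormal E \<and> span E = span B"
  using assms
proof (induction B)
  case empty
  then show ?case by (intro exI[of _ "{}"]) (simp add: orthonormal_def)
next
  case (insert b B)
  then obtain E where E: "finite E" "orthonormal E" "span E = span B" by auto
  have b: "b \<in> V" using insert by simp
  let ?r = "b - proj_sum E b"
  have r: "?r \<in> V" using b proj_sum_in[OF E(2)] by simp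
  have ps: "proj_sum E b \<in> span E"
    unfolding proj_sum_def by (intro span_sum span_scale span_base)
  show ?case
  proof (cases "?r = 0")
    case True
    then have "b \<in> span B" using ps E(3) by simp
    then show ?thesis using E by (intro exI[of _ E]) (simp add: span_redundant)
  next
    case False
    define n where "n = nrm ip ?r"
    have n: "n > 0" using nrm_nonneg[OF r] nrm_eq_0_iff[OF r] False unfolding n_def by linarith
    define e where "e = scale (of_real (inverse n)) ?r"
    have eV: "e \<in> V" unfolding e_def using r by simp
    have orth: "ip e f = 0" if "f \<in> E" for f
    proof -
      have "ip ?r f = 0"
        using that b proj_sum_in[OF E(2), of b] orthonormal_in[OF E(2)]
          ip_orthonormal_sum[OF E(2) that E(1), of "\<lambda>e. ip b e"]
        by (simp add: form_diff_left proj_sum_def)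
      then show ?thesis
        using that r orthonormal_in[OF E(2)] unfolding e_def by (simp add: form_scale_left)
    qed
    have "nrm ip e = cmod (of_real (inverse n)) * n"
      unfolding e_def n_def using r by (rule nrm_scale)
    then have "nrm ip e = 1" using n by (simp add: norm_inverse)
    then have e1: "ip e e = 1" using form_self[OF eV] by simp
    have "ip f e = 0" if "f \<in> E" for f
      using orth[OF that] form_cnj[of e f] eV orthonormal_in[OF E(2) that] by simp
    then have "orthonormal (insert e E)"
      using E(2) eV e1 orth unfolding orthonormal_def by auto
    moreover have "span (insert e E) = span (insert b B)"
    proof -
      have "b = scale (of_real n) e + proj_sum E b"
        using n unfolding e_def by (simp add: scale_scale)
      then have "b \<in> span (insert e E)"
        using ps span_mono[of E "insert e E"]
        by (metis insertI1 span_add span_base span_scale subsetD subset_insertI)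
      moreover have "B \<subseteq> span (insert e E)"
        using E(3) span_superset[of B] span_mono[of E "insert e E"] by blast
      moreover have spE: "span E \<subseteq> span (insert b B)"
        using E(3) span_mono[of B "insert b B"] by blast
      moreover have "e \<in> span (insert b B)"
        unfolding e_def using ps spE by (intro span_scale span_diff) (auto intro: span_base)
      moreover have "E \<subseteq> span (insert b B)" using spE span_superset by blast
      ultimately show ?thesis
        by (simp add: span_eq)
    qed
    ultimately show ?thesis using E(1) by (intro exI[of _ "insert e E"]) simp
  qed
qed

lemma orthonormal_independent:
  assumes "orthonormal E" "finite E"
  shows "independent E"
proof (rule independent_if_scalars_zero[OF assms(2)])
  fix c e assume "(\<Sum>x\<in>E. scale (c x) x) = 0" "e \<in> E"
  then show "c e = 0"
    using ip_orthonormal_sum[OF assms(1) \<open>e \<in> E\<close> assms(2), of c] orthonormal_in[OF assms(1)]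
    by simp
qed

text \<open>The lower bound (1 - q) \<parallel>x\<parallel> \<le> \<parallel>x - G x\<parallel>
  carries the proof. It makes the partial sums of the geometric series Cauchy, because Id - G maps
  the n-th one to y - G^n y. It also bounds the pointwise chosen \<open>M\<close> and, through
  uniqueness of solutions, makes \<open>M\<close> linear and commute with \<open>G\<close>.\<close>

lemma Neumann_inverse:
  assumes G: "linear_on V G" "G ` V \<subseteq> V"
    and q: "\<And>x. x \<in> V \<Longrightarrow> nrm ip (G x) \<le> q * nrm ip x" "0 \<le> q" "q < 1"
  shows "\<exists>M. bounded_op M \<and> (\<forall>y\<in>V. M y - G (M y) = y) \<and> (\<forall>y\<in>V. M (G y) = G (M y))"
proof -
  have GV [simp]: "G x \<in> V" if "x \<in> V" for x using G(2) that by blast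
  have Gadd: "G (x + y) = G x + G y" if "x \<in> V" "y \<in> V" for x y
    using G(1) that by (simp add: linear_on_def)
  have Gscale: "G (scale c x) = scale c (G x)" if "x \<in> V" for c x
    using G(1) that by (simp add: linear_on_def)
  have Gdiff: "G (x - y) = G x - G y" if "x \<in> V" "y \<in> V" for x y
    using Gadd[of "x - y" y] that by simp
  have lower: "(1 - q) * nrm ip x \<le> nrm ip (x - G x)" if "x \<in> V" for x
    using nrm_triangle_sub[of x "G x"] q(1)[OF that] that by (simp add: algebra_simps)
  have uniq: "x = x'" if "x \<in> V" "x' \<in> V" "x - G x = x' - G x'" for x x'
  proof -
    have "(x - x') - G (x - x') = (x - G x) - (x' - G x')"
      using that(1,2) by (simp add: Gdiff algebra_simps)
    then have "(x - x') - G (x - x') = 0" using that(3) by simp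
    then have "(1 - q) * nrm ip (x - x') \<le> 0" using lower[of "x - x'"] that by simp
    then have "nrm ip (x - x') \<le> 0" using q(3) by (simp add: mult_le_0_iff)
    then show ?thesis using that nrm_le_0D[of "x - x'"] by simp
  qed
  have ex: "\<exists>x\<in>V. x - G x = y" if y: "y \<in> V" for y
  proof -
    define X where "X n = (\<Sum>k<n. (G ^^ k) y)" for n
    have GkV: "(G ^^ k) y \<in> V" for k by (induction k) (simp_all add: y)
    have XV: "X n \<in> V" for n unfolding X_def using GkV by simp
    have Gk: "nrm ip ((G ^^ k) y) \<le> q ^ k * nrm ip y" for k
    proof (induction k)
      case (Suc k)
      have "nrm ip (G ((G ^^ k) y)) \<le> q * nrm ip ((G ^^ k) y)" using q(1) GkV by blast
      also have "\<dots> \<le> q * (q ^ k * nrm ip y)" using Suc q(2) by (rule mult_left_mono)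
      finally show ?case by (simp add: mult_ac)
    qed simp
    have GX: "X n - G (X n) = y - (G ^^ n) y" for n
    proof (induction n)
      case (Suc n)
      have XS: "X (Suc n) = X n + (G ^^ n) y" by (simp add: X_def)
      have "X (Suc n) - G (X (Suc n)) = (X n - G (X n)) + ((G ^^ n) y - G ((G ^^ n) y))"
        unfolding XS using XV GkV by (simp add: Gadd)
      then show ?case by (simp add: Suc)
    qed (use Gscale[of 0 0] in \<open>simp add: X_def\<close>)
    have lim0: "(\<lambda>k. q ^ k * nrm ip y) \<longlonglongrightarrow> 0"
      using q by (intro tendsto_mult_left_zero LIMSEQ_realpow_zero) auto
    have close: "nrm ip (X m - X n) \<le> (q ^ m * nrm ip y + q ^ n * nrm ip y) / (1 - q)" for m n
    proof -
      have "(X m - X n) - G (X m - X n) = (X m - G (X m)) - (X n - G (X n))"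
        using XV by (simp add: Gdiff algebra_simps)
      also have "\<dots> = (G ^^ n) y - (G ^^ m) y" unfolding GX by simp
      finally have "(1 - q) * nrm ip (X m - X n) \<le> nrm ip ((G ^^ n) y - (G ^^ m) y)"
        using lower[of "X m - X n"] XV by simp
      also have "\<dots> \<le> q ^ m * nrm ip y + q ^ n * nrm ip y"
        using nrm_triangle_diff[OF GkV GkV, of n m] Gk[of n] Gk[of m] by linarith
      finally show ?thesis using q(3) by (simp add: field_simps)
    qed
    have "cauchy_in V ip X"
      unfolding cauchy_in_def
    proof (intro conjI allI impI)
      fix e :: real assume "e > 0"
      then have "0 < e * (1 - q) / 2" using q(3) by simp
      then obtain N where N: "\<And>n. n \<ge> N \<Longrightarrow> q ^ n * nrm ip y < e * (1 - q) / 2"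
        using order_tendstoD(2)[OF lim0] unfolding eventually_sequentially by metis
      show "\<exists>N. \<forall>m\<ge>N. \<forall>n\<ge>N. nrm ip (X m - X n) < e"
      proof (intro exI[of _ N] allI impI)
        fix m n assume "N \<le> m" "N \<le> n"
        then have "q ^ m * nrm ip y + q ^ n * nrm ip y < e * (1 - q)"
          using N[of m] N[of n] by simp
        then have "(q ^ m * nrm ip y + q ^ n * nrm ip y) / (1 - q) < e"
          using q(3) by (simp add: field_simps)
        then show "nrm ip (X m - X n) < e" using close[of m n] by linarith
      qed
    qed (rule XV)
    then obtain x where x: "converges_in V ip X x" using complete_V by blast
    have xV: "x \<in> V" and limx: "(\<lambda>n. nrm ip (X n - x)) \<longlonglongrightarrow> 0"
      using x by (auto simp: converges_in_def)
    have bound: "nrm ip (x - G x - y) \<le> (1 + q) * nrm ip (X n - x) + q ^ n * nrm ip y" for n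
    proof -
      have "x - G x - y = (x - X n) - G (x - X n) - (G ^^ n) y"
        using GX[of n] xV XV by (simp add: Gdiff algebra_simps)
      also have "nrm ip \<dots> \<le> nrm ip ((x - X n) - G (x - X n)) + nrm ip ((G ^^ n) y)"
        using xV XV GkV by (intro nrm_triangle_diff) simp_all
      also have "nrm ip ((x - X n) - G (x - X n)) \<le> nrm ip (x - X n) + nrm ip (G (x - X n))"
        using xV XV by (intro nrm_triangle_diff) simp_all
      also have "nrm ip (G (x - X n)) \<le> q * nrm ip (x - X n)" using q(1) xV XV by simp
      finally show ?thesis
        using Gk[of n] xV XV nrm_diff_commute[of x "X n"] by (simp add: algebra_simps)
    qed
    have "(\<lambda>n. (1 + q) * nrm ip (X n - x) + q ^ n * nrm ip y) \<longlonglongrightarrow> (1 + q) * 0 + 0"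
      by (intro tendsto_add tendsto_mult tendsto_const limx lim0)
    then have "nrm ip (x - G x - y) \<le> 0"
      using bound by (intro LIMSEQ_le_const) auto
    then have "x - G x - y = 0"
      using xV y by (intro nrm_le_0D) simp_all
    then show ?thesis using xV by (intro bexI[of _ x]) simp_all
  qed
  then obtain M where M: "\<And>y. y \<in> V \<Longrightarrow> M y \<in> V" "\<And>y. y \<in> V \<Longrightarrow> M y - G (M y) = y"
    by metis
  have Madd: "M (x + y) = M x + M y" if "x \<in> V" "y \<in> V" for x y
  proof (rule uniq)
    have "M x + M y - G (M x + M y) = (M x - G (M x)) + (M y - G (M y))"
      using M(1) that by (simp add: Gadd)
    then show "M (x + y) - G (M (x + y)) = M x + M y - G (M x + M y)"
      using M(2) that by simp
  qed (simp_all add: M(1) that)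
  have Mscale: "M (scale c x) = scale c (M x)" if "x \<in> V" for c x
  proof (rule uniq)
    have "scale c (M x) - G (scale c (M x)) = scale c (M x - G (M x))"
      using M(1) that by (simp add: Gscale scale_right_diff_distrib)
    then show "M (scale c x) - G (M (scale c x)) = scale c (M x) - G (scale c (M x))"
      using M(2) that by simp
  qed (simp_all add: M(1) that)
  have "nrm ip (M y) \<le> inverse (1 - q) * nrm ip y" if "y \<in> V" for y
    using lower[of "M y"] M that q(3) by (simp add: field_simps)
  then have "bounded_op M"
    unfolding bounded_op_def linear_on_def using M(1) Madd Mscale by blast
  moreover have "M (G y) = G (M y)" if y: "y \<in> V" for y
  proof (rule uniq)
    have "G (M y) - G (G (M y)) = G (M y - G (M y))" using M(1) y by (simp add: Gdiff)
    then show "M (G y) - G (M (G y)) = G (M y) - G (G (M y))" using M(2) y by simp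
  qed (simp_all add: M(1) y)
  ultimately show ?thesis using M(2) by blast
qed

section \<open>Bounded operators and functionals\<close>

lemma bounded_op_in: "bounded_op T \<Longrightarrow> x \<in> V \<Longrightarrow> T x \<in> V"
  unfolding bounded_op_def by blast

lemma bounded_op_add: "\<lbrakk>bounded_op T; x \<in> V; y \<in> V\<rbrakk> \<Longrightarrow> T (x + y) = T x + T y"
  unfolding bounded_op_def linear_on_def by blast

lemma bounded_op_scale: "\<lbrakk>bounded_op T; x \<in> V\<rbrakk> \<Longrightarrow> T (scale c x) = scale c (T x)"
  unfolding bounded_op_def linear_on_def by blast

lemma bounded_op_diff:
  assumes "bounded_op T" "x \<in> V" "y \<in> V"
  shows "T (x - y) = T x - T y"
  using bounded_op_add[OF assms(1), of "x - y" y] assms by simp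

lemma bounded_op_zero: "bounded_op T \<Longrightarrow> T 0 = 0"
  using bounded_op_scale[of T 0 0] by simp

lemma bounded_op_sum:
  assumes "bounded_op T" "\<And>i. i \<in> I \<Longrightarrow> f i \<in> V"
  shows "T (sum f I) = (\<Sum>i\<in>I. T (f i))"
  using assms(2)
  by (induction I rule: infinite_finite_induct)
     (simp_all add: bounded_op_add[OF assms(1)] bounded_op_zero[OF assms(1)])

lemma bounded_op_bound:
  assumes "bounded_op T"
  obtains C where "C \<ge> 0" "\<And>x. x \<in> V \<Longrightarrow> nrm ip (T x) \<le> C * nrm ip x"
proof -
  obtain C where C: "\<And>x. x \<in> V \<Longrightarrow> nrm ip (T x) \<le> C * nrm ip x"
    using assms unfolding bounded_op_def by blast
  have "nrm ip (T x) \<le> \<bar>C\<bar> * nrm ip x" if "x \<in> V" for x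
    using C[OF that] mult_right_mono[OF abs_ge_self nrm_nonneg[OF that], of C] by linarith
  then show ?thesis using that[of "\<bar>C\<bar>"] by simp
qed

lemma bounded_opI:
  assumes "\<And>x. x \<in> V \<Longrightarrow> T x \<in> V"
    and "\<And>x y. x \<in> V \<Longrightarrow> y \<in> V \<Longrightarrow> T (x + y) = T x + T y"
    and "\<And>c x. x \<in> V \<Longrightarrow> T (scale c x) = scale c (T x)"
    and "\<And>x. x \<in> V \<Longrightarrow> nrm ip (T x) \<le> C * nrm ip x"
  shows "bounded_op T"
  using assms unfolding bounded_op_def linear_on_def by blast

lemma bounded_op_comp:
  assumes S: "bounded_op S" and T: "bounded_op T"
  shows "bounded_op (\<lambda>x. S (T x))"
proof -
  obtain C where C: "C \<ge> 0" "\<And>x. x \<in> V \<Longrightarrow> nrm ip (S x) \<le> C * nrm ip x"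
    using bounded_op_bound[OF S] by blast
  obtain D where D: "D \<ge> 0" "\<And>x. x \<in> V \<Longrightarrow> nrm ip (T x) \<le> D * nrm ip x"
    using bounded_op_bound[OF T] by blast
  show ?thesis
  proof (rule bounded_opI)
    fix x assume x: "x \<in> V"
    have "nrm ip (S (T x)) \<le> C * nrm ip (T x)" using C(2) bounded_op_in[OF T x] .
    also have "\<dots> \<le> C * (D * nrm ip x)" using D(2)[OF x] C(1) by (rule mult_left_mono)
    finally show "nrm ip (S (T x)) \<le> (C * D) * nrm ip x" by (simp add: mult.assoc)
  qed (simp_all add: S T bounded_op_in bounded_op_add bounded_op_scale)
qed

lemma bounded_op_diff_op:
  assumes S: "bounded_op S" and T: "bounded_op T"
  shows "bounded_op (\<lambda>x. S x - T x)"
proof -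
  obtain C where C: "C \<ge> 0" "\<And>x. x \<in> V \<Longrightarrow> nrm ip (S x) \<le> C * nrm ip x"
    using bounded_op_bound[OF S] by blast
  obtain D where D: "D \<ge> 0" "\<And>x. x \<in> V \<Longrightarrow> nrm ip (T x) \<le> D * nrm ip x"
    using bounded_op_bound[OF T] by blast
  show ?thesis
  proof (rule bounded_opI)
    fix x assume x: "x \<in> V"
    have "nrm ip (S x - T x) \<le> nrm ip (S x) + nrm ip (T x)"
      using x S T by (simp add: nrm_triangle_diff bounded_op_in)
    also have "\<dots> \<le> C * nrm ip x + D * nrm ip x" using C D x by (simp add: add_mono)
    finally show "nrm ip (S x - T x) \<le> (C + D) * nrm ip x" by (simp add: algebra_simps)
  qed (simp_all add: S T bounded_op_in bounded_op_add bounded_op_scale scale_right_diff_distrib)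
qed

text \<open>The constant is carried explicitly, so that nuclear expansions can sum bounds instead of
  dual norms.\<close>

definition functional_bound :: "('a \<Rightarrow> complex) \<Rightarrow> real \<Rightarrow> bool" where
  "functional_bound \<phi> c \<longleftrightarrow> 0 \<le> c \<and>
     (\<forall>x\<in>V. \<forall>y\<in>V. \<phi> (x + y) = \<phi> x + \<phi> y) \<and> (\<forall>a. \<forall>x\<in>V. \<phi> (scale a x) = a * \<phi> x) \<and>
     (\<forall>x\<in>V. cmod (\<phi> x) \<le> c * nrm ip x)"

lemma functional_add: "\<lbrakk>functional_bound \<phi> c; x \<in> V; y \<in> V\<rbrakk> \<Longrightarrow> \<phi> (x + y) = \<phi> x + \<phi> y"
  and functional_scale: "\<lbrakk>functional_bound \<phi> c; x \<in> V\<rbrakk> \<Longrightarrow> \<phi> (scale a x) = a * \<phi> x"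
  and functional_le: "\<lbrakk>functional_bound \<phi> c; x \<in> V\<rbrakk> \<Longrightarrow> cmod (\<phi> x) \<le> c * nrm ip x"
  and functional_bound_nonneg: "functional_bound \<phi> c \<Longrightarrow> 0 \<le> c"
  unfolding functional_bound_def by blast+

lemma functional_zero: "functional_bound \<phi> c \<Longrightarrow> \<phi> 0 = 0"
  using functional_scale[of \<phi> c 0 0] by simp

lemma functional_diff: "\<lbrakk>functional_bound \<phi> c; x \<in> V; y \<in> V\<rbrakk> \<Longrightarrow> \<phi> (x - y) = \<phi> x - \<phi> y"
  using functional_add[of \<phi> c "x - y" y] by simp

lemma functional_sum:
  assumes "functional_bound \<phi> c" "\<And>i. i \<in> I \<Longrightarrow> f i \<in> V"
  shows "\<phi> (sum f I) = (\<Sum>i\<in>I. \<phi> (f i))"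
  using assms(2)
  by (induction I rule: infinite_finite_induct)
     (simp_all add: functional_add[OF assms(1)] functional_zero[OF assms(1)])

lemma functional_bound_ip: "y \<in> V \<Longrightarrow> functional_bound (\<lambda>x. ip x y) (nrm ip y)"
  unfolding functional_bound_def
  by (auto simp: form_add_left form_scale_left mult.commute[of "nrm ip y"] form_Cauchy_Schwarz)

lemma functional_bound_comp:
  assumes \<phi>: "functional_bound \<phi> c" and T: "bounded_op T"
    and C: "C \<ge> 0" "\<And>x. x \<in> V \<Longrightarrow> nrm ip (T x) \<le> C * nrm ip x"
  shows "functional_bound (\<lambda>x. \<phi> (T x)) (c * C)"
proof -
  have c: "0 \<le> c" using \<phi> by (rule functional_bound_nonneg)
  have "cmod (\<phi> (T x)) \<le> c * C * nrm ip x" if x: "x \<in> V" for x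
  proof -
    have "cmod (\<phi> (T x)) \<le> c * nrm ip (T x)"
      using functional_le[OF \<phi> bounded_op_in[OF T x]] .
    also have "\<dots> \<le> c * (C * nrm ip x)" using C(2)[OF x] c by (rule mult_left_mono)
    finally show ?thesis by (simp add: mult.assoc)
  qed
  then show ?thesis
    unfolding functional_bound_def
    using c C(1) T \<phi>
    by (simp add: bounded_op_in bounded_op_add bounded_op_scale
        functional_add[OF \<phi>] functional_scale[OF \<phi>])
qed

lemma functional_Fourier:
  assumes E: "orthonormal_basis E" and \<phi>: "functional_bound \<phi> c" and u: "u \<in> V"
  shows "((\<lambda>e. ip u e * \<phi> e) has_sum \<phi> u) E"
  unfolding has_sum_def
proof (rule tendstoI)
  fix \<epsilon> :: real assume \<epsilon>: "\<epsilon> > 0"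
  have c: "0 \<le> c" using \<phi> by (rule functional_bound_nonneg)
  have on: "orthonormal E" using E by (simp add: orthonormal_basis_iff)
  obtain F0 where F0: "finite F0" "F0 \<subseteq> E"
    "\<And>F. finite F \<Longrightarrow> F0 \<subseteq> F \<Longrightarrow> F \<subseteq> E \<Longrightarrow> nrm ip (u - proj_sum F u) < \<epsilon> / (c + 1)"
    using Fourier_approximation[OF E u, of "\<epsilon> / (c + 1)"] \<epsilon> c by auto
  have "dist (\<Sum>e\<in>F. ip u e * \<phi> e) (\<phi> u) < \<epsilon>" if F: "finite F" "F0 \<subseteq> F" "F \<subseteq> E" for F
  proof -
    have onF: "orthonormal F" using on F(3) by (rule orthonormal_subset)
    have ps: "proj_sum F u \<in> V" using onF by (rule proj_sum_in)
    have "\<phi> (proj_sum F u) = (\<Sum>e\<in>F. ip u e * \<phi> e)"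
      unfolding proj_sum_def using orthonormal_in[OF onF]
      by (simp add: functional_sum[OF \<phi>] functional_scale[OF \<phi>])
    then have "dist (\<Sum>e\<in>F. ip u e * \<phi> e) (\<phi> u) = cmod (\<phi> (u - proj_sum F u))"
      using ps u by (simp add: functional_diff[OF \<phi>] dist_norm norm_minus_commute)
    also have "\<dots> \<le> c * nrm ip (u - proj_sum F u)"
      using ps u by (intro functional_le[OF \<phi>]) simp
    also have "\<dots> \<le> (c + 1) * nrm ip (u - proj_sum F u)"
      using ps u by (intro mult_right_mono) simp_all
    also have "\<dots> < \<epsilon>" using F0(3)[OF F] c by (simp add: field_simps)
    finally show ?thesis .
  qed
  then show "\<forall>\<^sub>F F in finite_subsets_at_top E. dist (\<Sum>e\<in>F. ip u e * \<phi> e) (\<phi> u) < \<epsilon>"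
    unfolding eventually_finite_subsets_at_top using F0(1,2) by blast
qed

text \<open>Bessel's inequality for functionals, without representing \<open>\<phi>\<close> by a
  vector. With s the sum on the left, \<open>\<phi>\<close> takes the value s at the vector
  \<open>?x\<close>, which has norm sqrt s; hence s \<le> c sqrt s.\<close>

lemma functional_sum_squares_le:
  assumes E: "orthonormal E" "finite E" and \<phi>: "functional_bound \<phi> c"
  shows "(\<Sum>e\<in>E. (cmod (\<phi> e))\<^sup>2) \<le> c\<^sup>2"
proof -
  have c: "0 \<le> c" using \<phi> by (rule functional_bound_nonneg)
  let ?s = "\<Sum>e\<in>E. (cmod (\<phi> e))\<^sup>2"
  let ?x = "\<Sum>e\<in>E. scale (cnj (\<phi> e)) e"
  have x: "?x \<in> V" using orthonormal_in[OF E(1)] by simp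
  have "\<phi> ?x = (\<Sum>e\<in>E. cnj (\<phi> e) * \<phi> e)"
    using orthonormal_in[OF E(1)] by (simp add: functional_sum[OF \<phi>] functional_scale[OF \<phi>])
  also have "\<dots> = of_real ?s"
    unfolding of_real_sum
    by (intro sum.cong refl) (simp only: complex_norm_square mult.commute)
  finally have "?s \<le> c * nrm ip ?x"
    using functional_le[OF \<phi> x] by (simp add: sum_nonneg flip: of_real_sum of_real_power)
  moreover have "nrm ip ?x = sqrt ?s"
    using nrm_power2_orthonormal_sum[OF E, of "\<lambda>e. cnj (\<phi> e)"] x
    by (simp add: real_sqrt_unique)
  ultimately have le: "?s \<le> c * sqrt ?s" by simp
  define r where "r = sqrt ?s"
  have ss: "?s = r * r" and r: "0 \<le> r" unfolding r_def by (simp_all add: sum_nonneg)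
  have "r * r \<le> c * r" using le r unfolding ss by simp
  then have "r \<le> c"
    using c r by (cases "r = 0") (simp_all add: mult_le_cancel_right)
  then have "r * r \<le> c * c" using r c by (intro mult_mono) simp_all
  then show ?thesis
    unfolding ss power2_eq_square[of c] .
qed

text \<open>Cauchy--Schwarz for the two coefficient families. The bound is uniform in
  \<open>E\<close>, which supplies the absolute summability behind the interchange of sums in
  \<open>nuclear_has_trace\<close>.\<close>

lemma functional_pairing_le:
  assumes E: "orthonormal E" "finite E" and \<phi>: "functional_bound \<phi> c" and u: "u \<in> V"
  shows "(\<Sum>e\<in>E. cmod (ip u e * \<phi> e)) \<le> c * nrm ip u"
proof -
  have c: "0 \<le> c" using \<phi> by (rule functional_bound_nonneg)
  have "(\<Sum>e\<in>E. cmod (ip u e * \<phi> e)) = (\<Sum>e\<in>E. \<bar>cmod (\<phi> e)\<bar> * \<bar>cmod (ip u e)\<bar>)"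
    by (simp add: norm_mult mult.commute)
  also have "\<dots> \<le> L2_set (\<lambda>e. cmod (\<phi> e)) E * L2_set (\<lambda>e. cmod (ip u e)) E"
    by (rule L2_set_mult_ineq)
  also have "\<dots> \<le> c * nrm ip u"
    using functional_sum_squares_le[OF E \<phi>] Bessel_inequality[OF E u] c u
    by (intro mult_mono) (auto simp: L2_set_def intro!: real_le_lsqrt sum_nonneg)
  finally show ?thesis .
qed

section \<open>Nuclear expansions and the trace\<close>

text \<open>An expansion \<open>T = \<Sum>k. \<phi>\<^sub>k(\<cdot>) u\<^sub>k\<close>, tested against all bounded functionals and not only the
  \<open>ip \<cdot> y\<close>, so that composing with a bounded operator on the left needs no adjoint.\<close>

definition nuclear_rep ::
    "'i set \<Rightarrow> ('i \<Rightarrow> 'a \<Rightarrow> complex) \<Rightarrow> ('i \<Rightarrow> 'a) \<Rightarrow> ('i \<Rightarrow> real) \<Rightarrow> ('a \<Rightarrow> 'a) \<Rightarrow> bool" where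
  "nuclear_rep I \<phi> u c T \<longleftrightarrow>
     (\<forall>x\<in>V. T x \<in> V) \<and> (\<forall>k\<in>I. functional_bound (\<phi> k) (c k) \<and> u k \<in> V) \<and>
     (\<lambda>k. c k * nrm ip (u k)) summable_on I \<and>
     (\<forall>x\<in>V. \<forall>\<psi> d. functional_bound \<psi> d \<longrightarrow> ((\<lambda>k. \<phi> k x * \<psi> (u k)) has_sum \<psi> (T x)) I)"

lemma nuclear_repD:
  assumes "nuclear_rep I \<phi> u c T"
  shows "\<And>x. x \<in> V \<Longrightarrow> T x \<in> V"
    and "\<And>k. k \<in> I \<Longrightarrow> functional_bound (\<phi> k) (c k)"
    and "\<And>k. k \<in> I \<Longrightarrow> u k \<in> V"
    and "(\<lambda>k. c k * nrm ip (u k)) summable_on I"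
    and "\<And>x \<psi> d. x \<in> V \<Longrightarrow> functional_bound \<psi> d \<Longrightarrow>
       ((\<lambda>k. \<phi> k x * \<psi> (u k)) has_sum \<psi> (T x)) I"
  using assms unfolding nuclear_rep_def by blast+

lemma nuclear_repI:
  assumes "\<And>x. x \<in> V \<Longrightarrow> T x \<in> V"
    and "\<And>k. k \<in> I \<Longrightarrow> functional_bound (\<phi> k) (c k)"
    and "\<And>k. k \<in> I \<Longrightarrow> u k \<in> V"
    and "(\<lambda>k. c k * nrm ip (u k)) summable_on I"
    and "\<And>x \<psi> d. x \<in> V \<Longrightarrow> functional_bound \<psi> d \<Longrightarrow>
       ((\<lambda>k. \<phi> k x * \<psi> (u k)) has_sum \<psi> (T x)) I"
  shows "nuclear_rep I \<phi> u c T"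
  using assms unfolding nuclear_rep_def by blast

definition has_trace :: "('a \<Rightarrow> 'a) \<Rightarrow> complex \<Rightarrow> bool" where
  "has_trace T t \<longleftrightarrow> (\<forall>E. orthonormal_basis E \<longrightarrow> ((\<lambda>e. ip (T e) e) has_sum t) E)"

lemma has_trace_diff:
  assumes S: "has_trace S s" and T: "has_trace T t"
    and V: "\<And>x. x \<in> V \<Longrightarrow> S x \<in> V" "\<And>x. x \<in> V \<Longrightarrow> T x \<in> V"
  shows "has_trace (\<lambda>x. S x - T x) (s - t)"
  unfolding has_trace_def
proof (intro allI impI)
  fix E assume E: "orthonormal_basis E"
  have "((\<lambda>e. ip (S e) e + - ip (T e) e) has_sum (s + - t)) E"
    using S T E unfolding has_trace_def by (intro has_sum_add has_sum_uminusI) auto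
  then have "((\<lambda>e. ip (S e) e - ip (T e) e) has_sum (s - t)) E" by simp
  then show "((\<lambda>e. ip (S e - T e) e) has_sum (s - t)) E"
    using E by (subst has_sum_cong[of _ _ "\<lambda>e. ip (S e) e - ip (T e) e"])
      (auto simp: orthonormal_basis_def V form_diff_left subset_iff)
qed

lemma has_trace_cong:
  assumes "has_trace S t" "\<And>x. x \<in> V \<Longrightarrow> S x = T x"
  shows "has_trace T t"
  unfolding has_trace_def
proof (intro allI impI)
  fix E assume E: "orthonormal_basis E"
  then have "\<And>e. e \<in> E \<Longrightarrow> e \<in> V" by (auto simp: orthonormal_basis_def)
  then show "((\<lambda>e. ip (T e) e) has_sum t) E"
    using assms E has_sum_cong[of E "\<lambda>e. ip (S e) e" "\<lambda>e. ip (T e) e" t]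
    unfolding has_trace_def by simp
qed

text \<open>\<open>has_trace\<close> quantifies over bases and would be vacuous if there were none;
  exhibiting one basis makes the value unique.\<close>

lemma op_trace_eq:
  assumes T: "has_trace T t" and E: "orthonormal_basis E"
  shows "op_trace T = t"
  unfolding op_trace_def
proof (rule the_equality)
  show "\<forall>E. orthonormal_basis E \<longrightarrow> ((\<lambda>e. ip (T e) e) has_sum t) E"
    using T unfolding has_trace_def .
  fix c assume "\<forall>E. orthonormal_basis E \<longrightarrow> ((\<lambda>e. ip (T e) e) has_sum c) E"
  then show "c = t" using T E has_sum_unique unfolding has_trace_def by blast
qed

text \<open>Fubini for the family \<open>ip (u k) e * \<phi> k e\<close>: summed over
  \<open>e\<close> it gives \<open>\<phi> k (u k)\<close>, summed over \<open>k\<close> it gives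
  \<open>ip (T e) e\<close>. The first order of summation shows that the value is the same for every
  basis. Absolute summability holds since the row of index \<open>k\<close> contributes at most
  \<open>c k * nrm ip (u k)\<close>.\<close>

lemma nuclear_has_trace:
  assumes T: "nuclear_rep I \<phi> u c T"
  shows "has_trace T (\<Sum>\<^sub>\<infinity>k\<in>I. \<phi> k (u k))"
  unfolding has_trace_def
proof (intro allI impI)
  fix E assume E: "orthonormal_basis E"
  have on: "orthonormal E" using E by (simp add: orthonormal_basis_iff)
  note TV = nuclear_repD(1)[OF T] and \<phi> = nuclear_repD(2)[OF T] and u = nuclear_repD(3)[OF T]
    and sm = nuclear_repD(4)[OF T] and rep = nuclear_repD(5)[OF T]
  define f where "f = (\<lambda>(k, e). ip (u k) e * \<phi> k e)"
  have fin: "(\<Sum>e\<in>F. norm (f (k, e))) \<le> c k * nrm ip (u k)"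
    if "k \<in> I" "finite F" "F \<subseteq> E" for k F
    using functional_pairing_le[OF orthonormal_subset[OF on that(3)] that(2) \<phi>[OF that(1)] u[OF that(1)]]
    by (simp add: f_def)
  have s1: "(\<lambda>e. norm (f (k, e))) summable_on E" if "k \<in> I" for k
    by (rule nonneg_bdd_above_summable_on)
       (auto intro!: bdd_aboveI[of _ "c k * nrm ip (u k)"] fin[OF that])
  have s2: "(\<Sum>\<^sub>\<infinity>e\<in>E. norm (f (k, e))) \<le> c k * nrm ip (u k)" if "k \<in> I" for k
    using infsum_le_finite_sums[OF s1[OF that]] fin[OF that] by blast
  have "(\<lambda>k. norm (\<Sum>\<^sub>\<infinity>e\<in>E. norm (f (k, e)))) summable_on I"
    by (rule summable_on_comparison_test[OF sm]) (use s2 in \<open>simp_all add: infsum_nonneg\<close>)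
  then have "(\<lambda>p. norm (f p)) summable_on I \<times> E"
    unfolding Infinite_Sum.abs_summable_on_Sigma_iff using s1 by simp
  then have "f summable_on I \<times> E" by (rule Infinite_Sum.abs_summable_summable)
  then obtain S where S: "(f has_sum S) (I \<times> E)" unfolding summable_on_def by blast
  have "((\<lambda>k. \<phi> k (u k)) has_sum S) I"
    by (rule has_sum_SigmaD[OF S]) (simp add: f_def functional_Fourier[OF E \<phi> u])
  then have S_eq: "(\<Sum>\<^sub>\<infinity>k\<in>I. \<phi> k (u k)) = S" by (rule infsumI)
  have "((\<lambda>e. ip (T e) e) has_sum S) E"
  proof (rule has_sum_SigmaD)
    show "((\<lambda>(e, k). f (k, e)) has_sum S) (E \<times> I)" using S by (subst has_sum_swap[symmetric])
    fix e assume "e \<in> E"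
    then have "e \<in> V" using on by (rule orthonormal_in[rotated])
    from rep[OF this functional_bound_ip[OF this]]
    show "((\<lambda>k. (\<lambda>(e, k). f (k, e)) (e, k)) has_sum ip (T e) e) I"
      by (simp add: f_def mult.commute)
  qed
  then show "((\<lambda>e. ip (T e) e) has_sum (\<Sum>\<^sub>\<infinity>k\<in>I. \<phi> k (u k))) E" by (simp add: S_eq)
qed

lemma nuclear_rep_comp_left:
  assumes T: "nuclear_rep I \<phi> u c T" and A: "bounded_op A"
  shows "nuclear_rep I \<phi> (\<lambda>k. A (u k)) c (\<lambda>x. A (T x))"
proof -
  obtain C where C: "C \<ge> 0" "\<And>x. x \<in> V \<Longrightarrow> nrm ip (A x) \<le> C * nrm ip x"
    using bounded_op_bound[OF A] by blast
  note TV = nuclear_repD(1)[OF T] and \<phi> = nuclear_repD(2)[OF T] and u = nuclear_repD(3)[OF T]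
    and sm = nuclear_repD(4)[OF T] and rep = nuclear_repD(5)[OF T]
  have sm': "(\<lambda>k. C * (c k * nrm ip (u k))) summable_on I"
    using sm by (rule summable_on_cmult_right)
  have le: "c k * nrm ip (A (u k)) \<le> C * (c k * nrm ip (u k))" if "k \<in> I" for k
    using mult_left_mono[OF C(2)[OF u[OF that]] functional_bound_nonneg[OF \<phi>[OF that]]]
    by (simp add: mult_ac)
  have "0 \<le> c k * nrm ip (A (u k))" if "k \<in> I" for k
    using functional_bound_nonneg[OF \<phi>[OF that]] bounded_op_in[OF A u[OF that]] by simp
  then have "(\<lambda>k. c k * nrm ip (A (u k))) summable_on I"
    using summable_on_comparison_test[OF sm' le] by blast
  then show ?thesis
  proof (rule nuclear_repI[rotated 3])
    fix x \<psi> d assume x: "x \<in> V" and \<psi>: "functional_bound \<psi> d"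
    show "((\<lambda>k. \<phi> k x * \<psi> (A (u k))) has_sum \<psi> (A (T x))) I"
      using rep[OF x functional_bound_comp[OF \<psi> A C]] .
  qed (simp_all add: bounded_op_in[OF A] TV u \<phi>)
qed

lemma nuclear_rep_comp_right:
  assumes T: "nuclear_rep I \<phi> u c T" and A: "bounded_op A"
  shows "\<exists>c'. nuclear_rep I (\<lambda>k x. \<phi> k (A x)) u c' (\<lambda>x. T (A x))"
proof -
  obtain C where C: "C \<ge> 0" "\<And>x. x \<in> V \<Longrightarrow> nrm ip (A x) \<le> C * nrm ip x"
    using bounded_op_bound[OF A] by blast
  note TV = nuclear_repD(1)[OF T] and \<phi> = nuclear_repD(2)[OF T] and u = nuclear_repD(3)[OF T]
    and sm = nuclear_repD(4)[OF T] and rep = nuclear_repD(5)[OF T]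
  have "(\<lambda>k. c k * C * nrm ip (u k)) summable_on I"
    using summable_on_cmult_right[OF sm, of C] by (simp add: mult_ac)
  then have "nuclear_rep I (\<lambda>k x. \<phi> k (A x)) u (\<lambda>k. c k * C) (\<lambda>x. T (A x))"
    unfolding nuclear_rep_def
    using functional_bound_comp[OF \<phi> A C] u TV bounded_op_in[OF A] rep by blast
  then show ?thesis by blast
qed

text \<open>Composition on the left changes \<open>u k\<close> into \<open>A (u k)\<close>,
  composition on the right precomposes \<open>\<phi> k\<close> with \<open>A\<close>; either way the
  trace is the sum of \<open>\<phi> k (A (u k))\<close>.\<close>

lemma nuclear_trace_commute:
  assumes T: "nuclear_rep I \<phi> u c T" and A: "bounded_op A"
  shows "\<exists>t. has_trace (\<lambda>x. A (T x)) t \<and> has_trace (\<lambda>x. T (A x)) t"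
proof -
  obtain c' where "nuclear_rep I (\<lambda>k x. \<phi> k (A x)) u c' (\<lambda>x. T (A x))"
    using nuclear_rep_comp_right[OF T A] ..
  then show ?thesis
    using nuclear_has_trace nuclear_has_trace[OF nuclear_rep_comp_left[OF T A]] by blast
qed

lemma nuclear_rep_finite:
  assumes "finite I" "\<And>k. k \<in> I \<Longrightarrow> functional_bound (\<phi> k) (c k)" "\<And>k. k \<in> I \<Longrightarrow> u k \<in> V"
  shows "nuclear_rep I \<phi> u c (\<lambda>x. \<Sum>k\<in>I. scale (\<phi> k x) (u k))"
  unfolding nuclear_rep_def
proof (intro conjI ballI allI impI)
  fix x \<psi> d assume "x \<in> V" "functional_bound \<psi> d"
  then show "((\<lambda>k. \<phi> k x * \<psi> (u k)) has_sum \<psi> (\<Sum>k\<in>I. scale (\<phi> k x) (u k))) I"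
    using assms by (intro has_sum_finiteI) (simp_all add: functional_sum functional_scale)
qed (use assms in auto)

text \<open>Outside a suitable finite \<open>J\<close> the numbers \<open>c k * nrm ip (u k)\<close>
  add up to at most \<open>q\<close>. The expansion converges only after a functional is applied, so
  the error \<open>?y\<close> is tested against itself and one factor of its norm is
  cancelled.\<close>

lemma nuclear_rep_split:
  assumes T: "nuclear_rep I \<phi> u c T" and q: "q > 0"
  shows "\<exists>J. finite J \<and> J \<subseteq> I \<and>
    (\<forall>x\<in>V. nrm ip (T x - (\<Sum>k\<in>J. scale (\<phi> k x) (u k))) \<le> q * nrm ip x)"
proof -
  note TV = nuclear_repD(1)[OF T] and \<phi> = nuclear_repD(2)[OF T] and u = nuclear_repD(3)[OF T]
    and sm = nuclear_repD(4)[OF T] and rep = nuclear_repD(5)[OF T]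
  define a where "a k = c k * nrm ip (u k)" for k
  have a: "(a has_sum infsum a I) I" using sm unfolding a_def by simp
  obtain J where J: "finite J" "J \<subseteq> I" "dist (sum a J) (infsum a I) \<le> q"
    using has_sum_finite_approximation[OF a q] by blast
  have a': "(a has_sum (infsum a I - sum a J)) (I - J)"
    using J by (intro has_sum_Diff[OF a] has_sum_finiteI) auto
  have "nrm ip (T x - (\<Sum>k\<in>J. scale (\<phi> k x) (u k))) \<le> q * nrm ip x" if x: "x \<in> V" for x
  proof -
    let ?F = "\<Sum>k\<in>J. scale (\<phi> k x) (u k)"
    let ?y = "T x - ?F"
    have F: "?F \<in> V" using u J(2) by (intro carrier_sum carrier_closed(4)) blast
    have y: "?y \<in> V" using F TV[OF x] by simp
    have F_y: "ip ?F ?y = (\<Sum>k\<in>J. \<phi> k x * ip (u k) ?y)"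
      using u J y by (simp add: form_sum_left form_scale_left subset_iff)
    have "((\<lambda>k. \<phi> k x * ip (u k) ?y) has_sum (ip (T x) ?y - ip ?F ?y)) (I - J)"
      by (rule has_sum_Diff[OF rep[OF x functional_bound_ip[OF y]] has_sum_finiteI[OF J(1) F_y] J(2)])
    moreover have "((\<lambda>k. a k * (nrm ip x * nrm ip ?y)) has_sum
        ((infsum a I - sum a J) * (nrm ip x * nrm ip ?y))) (I - J)"
      using a' by (rule has_sum_cmult_left)
    moreover have "norm (\<phi> k x * ip (u k) ?y) \<le> a k * (nrm ip x * nrm ip ?y)" if "k \<in> I - J" for k
    proof -
      have "norm (\<phi> k x * ip (u k) ?y) \<le> (c k * nrm ip x) * (nrm ip (u k) * nrm ip ?y)"
        unfolding norm_mult using that x y u[of k] functional_bound_nonneg[OF \<phi>[of k]]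
        by (intro mult_mono functional_le[OF \<phi>] form_Cauchy_Schwarz) simp_all
      then show ?thesis by (simp add: a_def mult_ac)
    qed
    ultimately have "norm (ip (T x) ?y - ip ?F ?y) \<le> (infsum a I - sum a J) * (nrm ip x * nrm ip ?y)"
      by (rule norm_infsum_le)
    also have "\<dots> \<le> q * (nrm ip x * nrm ip ?y)"
      using J(3) x y by (intro mult_right_mono) (simp_all add: dist_norm)
    also have "ip (T x) ?y - ip ?F ?y = ip ?y ?y"
      using TV[OF x] F y by (simp add: form_diff_left)
    also have "norm (ip ?y ?y) = nrm ip ?y * nrm ip ?y"
      unfolding form_self[OF y] norm_of_real by (simp add: power2_eq_square)
    finally have "nrm ip ?y * nrm ip ?y \<le> (q * nrm ip x) * nrm ip ?y" by (simp add: mult_ac)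
    then show ?thesis
      using nrm_nonneg[OF y] nrm_nonneg[OF x] q
      by (cases "nrm ip ?y = 0") (simp_all add: mult_le_cancel_right)
  qed
  then show ?thesis using J by blast
qed

text \<open>\<open>proj_sum B\<close> is the identity on the values of \<open>F\<close>, which turns
  \<open>F\<close> into a finite nuclear expansion along \<open>B\<close>.\<close>

lemma finite_rank_has_trace:
  assumes F: "bounded_op F" and B: "orthonormal B" "finite B"
    and rng: "\<And>x. x \<in> V \<Longrightarrow> F x \<in> span B"
  shows "has_trace F (\<Sum>b\<in>B. ip (F b) b)"
proof -
  obtain C where C: "C \<ge> 0" "\<And>x. x \<in> V \<Longrightarrow> nrm ip (F x) \<le> C * nrm ip x"
    using bounded_op_bound[OF F] by blast
  have BV: "\<And>b. b \<in> B \<Longrightarrow> b \<in> V" using B(1) by (rule orthonormal_in)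
  have "nuclear_rep B (\<lambda>b x. ip (F x) b) (\<lambda>b. b) (\<lambda>b. nrm ip b * C)
      (\<lambda>x. \<Sum>b\<in>B. scale (ip (F x) b) b)"
    using functional_bound_comp[OF functional_bound_ip F C] B(2) BV
    by (intro nuclear_rep_finite) auto
  from nuclear_has_trace[OF this]
  have "has_trace (\<lambda>x. \<Sum>b\<in>B. scale (ip (F x) b) b) (\<Sum>b\<in>B. ip (F b) b)"
    using B(2) by simp
  then show ?thesis
    by (rule has_trace_cong) (use proj_sum_id[OF B rng] in \<open>simp add: proj_sum_def\<close>)
qed

lemma bounded_op_finite_rank:
  assumes "\<And>k. k \<in> J \<Longrightarrow> functional_bound (\<phi> k) (c k)" and u: "\<And>k. k \<in> J \<Longrightarrow> u k \<in> V"
  shows "bounded_op (\<lambda>x. \<Sum>k\<in>J. scale (\<phi> k x) (u k))"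
proof (rule bounded_opI)
  fix x assume x: "x \<in> V"
  show "(\<Sum>k\<in>J. scale (\<phi> k x) (u k)) \<in> V" using u by simp
  have "nrm ip (\<Sum>k\<in>J. scale (\<phi> k x) (u k)) \<le> (\<Sum>k\<in>J. nrm ip (scale (\<phi> k x) (u k)))"
    using u by (intro nrm_sum_le) simp
  also have "\<dots> \<le> (\<Sum>k\<in>J. c k * nrm ip x * nrm ip (u k))"
    using u functional_le[OF assms(1) x] by (intro sum_mono) (simp add: nrm_scale mult_right_mono)
  also have "\<dots> = (\<Sum>k\<in>J. c k * nrm ip (u k)) * nrm ip x"
    by (simp add: sum_distrib_left sum_distrib_right mult_ac)
  finally show "nrm ip (\<Sum>k\<in>J. scale (\<phi> k x) (u k)) \<le> (\<Sum>k\<in>J. c k * nrm ip (u k)) * nrm ip x" .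
  show "(\<Sum>k\<in>J. scale (\<phi> k (scale a x)) (u k)) = scale a (\<Sum>k\<in>J. scale (\<phi> k x) (u k))" for a
    using x by (simp add: functional_scale[OF assms(1)] scale_sum_right)
  show "(\<Sum>k\<in>J. scale (\<phi> k (x + y)) (u k)) =
      (\<Sum>k\<in>J. scale (\<phi> k x) (u k)) + (\<Sum>k\<in>J. scale (\<phi> k y) (u k))" if "y \<in> V" for y
    using x that by (simp add: functional_add[OF assms(1)] scale_left_distrib sum.distrib)
qed

text \<open>Both sides are the same double sum of matrix entries. Linearity is asked only on the two
  spans, because the corrected parametrix contains \<open>D\<close>, which is controlled only on
  \<open>H 0\<close>.\<close>

lemma finite_trace_commute:
  assumes E: "orthonormal E" "finite E" and F: "orthonormal F" "finite F"
    and A: "linear_on (span E) A" "A ` span E \<subseteq> span F"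
    and B: "linear_on (span F) B" "B ` span F \<subseteq> span E"
  shows "(\<Sum>e\<in>E. ip (B (A e)) e) = (\<Sum>f\<in>F. ip (A (B f)) f)"
proof -
  have EV: "\<And>e. e \<in> E \<Longrightarrow> e \<in> V" and FV: "\<And>f. f \<in> F \<Longrightarrow> f \<in> V"
    using E F orthonormal_in by blast+
  have AE: "\<And>e. e \<in> E \<Longrightarrow> A e \<in> span F" and BF: "\<And>f. f \<in> F \<Longrightarrow> B f \<in> span E"
    using A(2) B(2) span_superset by blast+
  have AV: "A e \<in> V" if "e \<in> E" for e
    using AE[OF that] span_minimal[of F V] FV subspace_V by blast
  have BV: "B f \<in> V" if "f \<in> F" for f
    using BF[OF that] span_minimal[of E V] EV subspace_V by blast
  have BA: "ip (B (A e)) e = (\<Sum>f\<in>F. ip (A e) f * ip (B f) e)" if e: "e \<in> E" for e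
  proof -
    have "B (A e) = B (\<Sum>f\<in>F. scale (ip (A e) f) f)"
      using proj_sum_id[OF F AE[OF e]] by (simp add: proj_sum_def)
    also have "\<dots> = (\<Sum>f\<in>F. scale (ip (A e) f) (B f))"
      by (rule linear_on_sum[OF subspace_span B(1)]) (rule span_base)
    finally show ?thesis using BV EV[OF e] by (simp add: form_sum_left form_scale_left)
  qed
  have AB: "ip (A (B f)) f = (\<Sum>e\<in>E. ip (B f) e * ip (A e) f)" if f: "f \<in> F" for f
  proof -
    have "A (B f) = A (\<Sum>e\<in>E. scale (ip (B f) e) e)"
      using proj_sum_id[OF E BF[OF f]] by (simp add: proj_sum_def)
    also have "\<dots> = (\<Sum>e\<in>E. scale (ip (B f) e) (A e))"
      by (rule linear_on_sum[OF subspace_span A(1)]) (rule span_base)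
    finally show ?thesis using AV FV[OF f] by (simp add: form_sum_left form_scale_left)
  qed
  have "(\<Sum>e\<in>E. ip (B (A e)) e) = (\<Sum>e\<in>E. \<Sum>f\<in>F. ip (A e) f * ip (B f) e)"
    by (simp add: BA)
  also have "\<dots> = (\<Sum>f\<in>F. \<Sum>e\<in>E. ip (A e) f * ip (B f) e)" by (rule sum.swap)
  finally show ?thesis by (simp add: AB mult.commute)
qed

end

section \<open>Trace class operators are nuclear\<close>

context positive_form_on
begin

text \<open>One elimination step. Positivity of the complement is Cauchy--Schwarz; when
  \<open>form e e\<close> is zero, division by zero leaves the form as it was.\<close>

lemma positive_form_schur_complement:
  assumes e: "e \<in> V"
  shows "positive_form_on scale V (\<lambda>x y. form x y - form x e * form e y / form e e)"
proof
  fix x y z c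
  show "subspace V" by (rule carrier_subspace)
  show "form (x + y) z - form (x + y) e * form e z / form e e =
      form x z - form x e * form e z / form e e + (form y z - form y e * form e z / form e e)"
    if "x \<in> V" "y \<in> V" "z \<in> V"
    using that e by (simp add: form_add_left ring_distribs add_divide_distrib)
  show "form (scale c x) y - form (scale c x) e * form e y / form e e =
      c * (form x y - form x e * form e y / form e e)"
    if "x \<in> V" "y \<in> V"
    using that e by (simp add: form_scale_left right_diff_distrib mult.assoc)
  show "form y x - form y e * form e x / form e e =
      cnj (form x y - form x e * form e y / form e e)"
    if "x \<in> V" "y \<in> V"
    using that e form_cnj[of x y] form_cnj[of x e] form_cnj[of e y] form_cnj[of e e] by simp
  show "0 \<le> Re (form x x - form x e * form e x / form e e)" if x: "x \<in> V"
  proof -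
    have "form x e * form e x = of_real ((cmod (form x e))\<^sup>2)"
      using form_cnj[OF x e] by (simp only: complex_norm_square)
    then have eq: "form x x - form x e * form e x / form e e =
        of_real ((nrm form x)\<^sup>2 - (cmod (form x e))\<^sup>2 / (nrm form e)\<^sup>2)"
      using x e by (simp add: form_self)
    have "(cmod (form x e))\<^sup>2 \<le> (nrm form x)\<^sup>2 * (nrm form e)\<^sup>2"
      using power_mono[OF form_Cauchy_Schwarz[OF x e] norm_ge_zero, of 2]
      by (simp add: power_mult_distrib)
    then have "(cmod (form x e))\<^sup>2 / (nrm form e)\<^sup>2 \<le> (nrm form x)\<^sup>2"
      by (cases "nrm form e = 0") (simp_all add: divide_le_eq)
    then show ?thesis unfolding eq by simp
  qed
qed

text \<open>Gram--Schmidt along \<open>e\<close> with respect to the possibly degenerate form: \<open>cholesky e n x\<close> is \<open>x\<close>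
  minus its projection to the span of \<open>e\<^sub>0, \<dots>, e\<^sub>n\<^sub>-\<^sub>1\<close>.  A zero pivot contributes nothing, as then
  \<open>x / 0 = 0\<close>.\<close>

primrec cholesky :: "(nat \<Rightarrow> 'a) \<Rightarrow> nat \<Rightarrow> 'a \<Rightarrow> 'a" where
  "cholesky e 0 x = x"
| "cholesky e (Suc n) x = cholesky e n x -
     scale (form (cholesky e n x) (e n) / form (cholesky e n (e n)) (e n)) (cholesky e n (e n))"

text \<open>The form left after \<open>n\<close> elimination steps, each of them a Schur complement
  by \<open>residual_Suc\<close>. Its diagonal is the defect in Bessel's inequality for the Cholesky
  vectors, see \<open>sum_form_cholesky_vector\<close>.\<close>

definition residual :: "(nat \<Rightarrow> 'a) \<Rightarrow> nat \<Rightarrow> 'a \<Rightarrow> 'a \<Rightarrow> complex" where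
  "residual e n x y = form (cholesky e n x) y"

context
  fixes e :: "nat \<Rightarrow> 'a"
  assumes e_in: "\<And>n. e n \<in> V"
begin

lemma cholesky_in [simp]: "x \<in> V \<Longrightarrow> cholesky e n x \<in> V"
  by (induction n arbitrary: x) (simp_all add: e_in)

lemma residual_Suc:
  assumes "x \<in> V" "y \<in> V"
  shows "residual e (Suc n) x y = residual e n x y -
    residual e n x (e n) * residual e n (e n) y / residual e n (e n) (e n)"
  using assms by (simp add: residual_def form_diff_left form_scale_left e_in)

lemma positive_form_residual: "positive_form_on scale V (residual e n)"
proof (induction n)
  case 0
  show ?case
    using positive_form_on_axioms by (simp add: residual_def[abs_def])
next
  case (Suc n)
  interpret R: positive_form_on scale V "residual e n" by (rule Suc)
  interpret S: positive_form_on scale V "\<lambda>x y. residual e n x y -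
      residual e n x (e n) * residual e n (e n) y / residual e n (e n) (e n)"
    by (rule R.positive_form_schur_complement[OF e_in])
  show ?case
  proof
    fix x y z c
    show "residual e (Suc n) (x + y) z = residual e (Suc n) x z + residual e (Suc n) y z"
      if "x \<in> V" "y \<in> V" "z \<in> V" using that S.form_add_left[OF that] by (simp add: residual_Suc)
    show "residual e (Suc n) (scale c x) y = c * residual e (Suc n) x y"
      if "x \<in> V" "y \<in> V" using that S.form_scale_left[OF that] by (simp add: residual_Suc)
    show "residual e (Suc n) y x = cnj (residual e (Suc n) x y)"
      if "x \<in> V" "y \<in> V" using that S.form_cnj[OF that] by (simp add: residual_Suc)
    show "0 \<le> Re (residual e (Suc n) x x)"
      if "x \<in> V" using that S.form_nonneg[OF that] by (simp add: residual_Suc)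
  qed (rule carrier_subspace)
qed

lemma residual_self_Suc:
  assumes x: "x \<in> V"
  shows "Re (residual e (Suc n) x x) = Re (residual e n x x) -
    (cmod (residual e n x (e n)))\<^sup>2 / Re (residual e n (e n) (e n))"
proof -
  interpret R: positive_form_on scale V "residual e n" by (rule positive_form_residual)
  have "residual e n x (e n) * residual e n (e n) x = of_real ((cmod (residual e n x (e n)))\<^sup>2)"
    using R.form_cnj[OF x e_in] by (simp only: complex_norm_square)
  moreover have "residual e n (e n) (e n) = of_real (Re (residual e n (e n) (e n)))"
    using R.Im_form_self[OF e_in] by (simp add: complex_eq_iff)
  ultimately have "residual e n x (e n) * residual e n (e n) x / residual e n (e n) (e n) =
      of_real ((cmod (residual e n x (e n)))\<^sup>2 / Re (residual e n (e n) (e n)))"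
    by (metis of_real_divide)
  then show ?thesis using x by (simp add: residual_Suc e_in)
qed

lemma residual_self_nonneg: "x \<in> V \<Longrightarrow> 0 \<le> Re (residual e n x x)"
  using positive_form_residual by (rule positive_form_on.form_nonneg)

lemma residual_self_antimono:
  assumes x: "x \<in> V" and "m \<le> n"
  shows "Re (residual e n x x) \<le> Re (residual e m x x)"
proof (rule lift_Suc_antimono_le[of "\<lambda>n. Re (residual e n x x)", OF _ \<open>m \<le> n\<close>])
  show "Re (residual e (Suc n) x x) \<le> Re (residual e n x x)" for n
    using residual_self_Suc[OF x, of n] residual_self_nonneg[OF e_in[of n], of n] by simp
qed

lemma residual_0: "residual e 0 = form"
  by (simp add: residual_def[abs_def])

text \<open>Eliminating \<open>e n\<close> subtracts r^2 / r from its diagonal value r, which leaves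
  0 even for r = 0. By monotonicity the value stays 0 from step n + 1 on.\<close>

lemma residual_pivot: "Re (residual e (Suc n) (e n) (e n)) = 0"
proof -
  interpret R: positive_form_on scale V "residual e n" by (rule positive_form_residual)
  have "cmod (residual e n (e n) (e n)) = Re (residual e n (e n) (e n))"
    using R.form_self[OF e_in[of n]] R.nrm_power2[OF e_in[of n]] by (metis norm_of_real abs_power2)
  then show ?thesis
    unfolding residual_self_Suc[OF e_in] by (simp add: power2_eq_square)
qed

definition pivot_sqrt :: "nat \<Rightarrow> real" where
  "pivot_sqrt n = sqrt (Re (residual e n (e n) (e n)))"

text \<open>The pivot vector normalised with respect to the form; a zero pivot gives the zero
  vector, since \<open>inverse 0 = 0\<close>.\<close>

definition cholesky_vector :: "nat \<Rightarrow> 'a" where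
  "cholesky_vector n = scale (of_real (inverse (pivot_sqrt n))) (cholesky e n (e n))"

lemma cholesky_vector_in [simp]: "cholesky_vector n \<in> V"
  by (simp add: cholesky_vector_def e_in)

lemma form_cholesky_vector:
  assumes x: "x \<in> V"
  shows "form x (cholesky_vector n) = of_real (inverse (pivot_sqrt n)) * residual e n x (e n)"
proof -
  interpret R: positive_form_on scale V "residual e n" by (rule positive_form_residual)
  have "form x (cholesky_vector n) = cnj (form (cholesky_vector n) x)"
    using x by (intro form_cnj) simp_all
  also have "\<dots> = of_real (inverse (pivot_sqrt n)) * cnj (residual e n (e n) x)"
    using x e_in by (simp add: cholesky_vector_def form_scale_left residual_def)
  also have "cnj (residual e n (e n) x) = residual e n x (e n)"
    using R.form_cnj[OF e_in x] by simp
  finally show ?thesis .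
qed

lemma pivot_sqrt_power2:
  "of_real ((pivot_sqrt n)\<^sup>2) = residual e n (e n) (e n)"
proof -
  interpret R: positive_form_on scale V "residual e n" by (rule positive_form_residual)
  show ?thesis
    using R.form_nonneg[OF e_in[of n]] R.Im_form_self[OF e_in[of n]]
    by (simp add: pivot_sqrt_def complex_eq_iff)
qed

text \<open>The inverse square root of the pivot occurs once in the coefficient and once in the
  vector, and the product is the quotient subtracted by \<open>cholesky\<close>.\<close>

lemma cholesky_telescope:
  assumes x: "x \<in> V"
  shows "x - (\<Sum>k<n. scale (form x (cholesky_vector k)) (cholesky_vector k)) = cholesky e n x"
proof (induction n)
  case (Suc n)
  have "scale (form x (cholesky_vector n)) (cholesky_vector n) =
      scale (residual e n x (e n) / residual e n (e n) (e n)) (cholesky e n (e n))"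
    unfolding form_cholesky_vector[OF x] pivot_sqrt_power2[symmetric]
    by (simp add: cholesky_vector_def power2_eq_square field_simps)
  moreover have "x - (\<Sum>k<Suc n. scale (form x (cholesky_vector k)) (cholesky_vector k)) =
      cholesky e n x - scale (form x (cholesky_vector n)) (cholesky_vector n)"
    unfolding Suc[symmetric] by (simp add: algebra_simps)
  ultimately show ?case by (simp add: residual_def)
qed simp

lemma sum_form_cholesky_vector:
  assumes x: "x \<in> V"
  shows "(\<Sum>k<n. (cmod (form x (cholesky_vector k)))\<^sup>2) = Re (form x x) - Re (residual e n x x)"
proof (induction n)
  case 0
  then show ?case by (simp add: residual_0)
next
  case (Suc n)
  have "(cmod (form x (cholesky_vector n)))\<^sup>2 =
      (cmod (residual e n x (e n)))\<^sup>2 / Re (residual e n (e n) (e n))"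
    using residual_self_nonneg[OF e_in[of n], of n]
    by (simp add: form_cholesky_vector[OF x] norm_mult power_mult_distrib pivot_sqrt_def
        norm_inverse power_inverse divide_inverse mult.commute del: of_real_inverse)
  then show ?case using residual_self_Suc[OF x, of n] by (simp add: Suc)
qed

end

end

context hilbert_space_on
begin

text \<open>Polarization: a form with real diagonal is Hermitian.\<close>

lemma positive_op_form:
  assumes A: "positive_op A"
  shows "positive_form_on scale V (\<lambda>x y. ip (A x) y)"
proof
  have bA: "bounded_op A" and real: "\<And>x. x \<in> V \<Longrightarrow> Im (ip (A x) x) = 0"
    and nonneg: "\<And>x. x \<in> V \<Longrightarrow> 0 \<le> Re (ip (A x) x)"
    using A unfolding positive_op_def by auto
  have AV: "\<And>x. x \<in> V \<Longrightarrow> A x \<in> V" using bA by (rule bounded_op_in)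
  fix x y z c
  show "subspace V" by (rule subspace_V)
  show "ip (A (x + y)) z = ip (A x) z + ip (A y) z" if "x \<in> V" "y \<in> V" "z \<in> V"
    using that bA by (simp add: bounded_op_add form_add_left AV)
  show "ip (A (scale c x)) y = c * ip (A x) y" if "x \<in> V" "y \<in> V"
    using that bA by (simp add: bounded_op_scale form_scale_left AV)
  show "ip (A y) x = cnj (ip (A x) y)" if xy: "x \<in> V" "y \<in> V"
  proof -
    have expand: "Im (a * ip (A y) x + cnj a * ip (A x) y) = 0" for a
    proof -
      have "ip (A (x + scale a y)) (x + scale a y) =
          ip (A x) x + (a * ip (A y) x + cnj a * ip (A x) y) + a * cnj a * ip (A y) y"
        using xy bA by (simp add: bounded_op_add bounded_op_scale form_add_left form_add_right
            form_scale_left form_scale_right AV algebra_simps)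
      then have "Im (a * ip (A y) x + cnj a * ip (A x) y) =
          Im (ip (A (x + scale a y)) (x + scale a y)) - Im (ip (A x) x) - Im (a * cnj a * ip (A y) y)"
        by simp
      also have "Im (a * cnj a * ip (A y) y) = 0"
        using real[OF xy(2)] by (simp add: complex_mult_cnj)
      finally show ?thesis using real xy by simp
    qed
    show ?thesis
      \<comment> \<open>The choice 1 makes the imaginary parts opposite, the choice \<i> makes the
        real parts equal.\<close>
      using expand[of 1] expand[of \<i>] by (simp add: complex_eq_iff)
  qed
  show "0 \<le> Re (ip (A x) x)" if "x \<in> V" using nonneg that .
qed

text \<open>Cholesky vectors \<open>g\<^sub>k\<close> of the form \<open>\<langle>A x, y\<rangle>\<close>, \<open>A = |T|\<close>, give
  \<open>T = \<Sum>k. \<langle>\<cdot>, A g\<^sub>k\<rangle> T g\<^sub>k\<close> with \<open>\<parallel>T g\<^sub>k\<parallel> = \<parallel>A g\<^sub>k\<parallel>\<close> and \<open>\<Sum>k. \<parallel>A g\<^sub>k\<parallel>\<^sup>2 \<le> tr A\<close>.\<close>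

lemma trace_class_nuclear_rep:
  assumes T: "trace_class T"
  shows "\<exists>(\<phi> :: nat \<Rightarrow> 'a \<Rightarrow> complex) g c. nuclear_rep UNIV \<phi> (\<lambda>k. T (g k)) c T \<and> (\<forall>k. g k \<in> V)"
proof -
  obtain A E where bT: "bounded_op T" and TA: "is_absolute_value T A"
    and E: "orthonormal_basis E" and sm: "(\<lambda>e. Re (ip (A e) e)) summable_on E"
    using T unfolding trace_class_def by blast
  have pos: "positive_op A"
    and sq: "\<And>x y. x \<in> V \<Longrightarrow> y \<in> V \<Longrightarrow> ip (A (A x)) y = ip (T x) (T y)"
    using TA unfolding is_absolute_value_def by auto
  have bA: "bounded_op A" using pos unfolding positive_op_def by blast
  have AV: "\<And>x. x \<in> V \<Longrightarrow> A x \<in> V" and TV: "\<And>x. x \<in> V \<Longrightarrow> T x \<in> V"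
    using bA bT bounded_op_in by blast+
  have on: "orthonormal E" and dense: "dense_in V ip (span E)"
    using E by (simp_all add: orthonormal_basis_iff)
  have EV: "\<And>e. e \<in> E \<Longrightarrow> e \<in> V" using on by (rule orthonormal_in)
  define a where "a x y = ip (A x) y" for x y
  interpret a: positive_form_on scale V a
    unfolding a_def by (rule positive_op_form[OF pos])
  obtain C where C: "C \<ge> 0" "\<And>x. x \<in> V \<Longrightarrow> nrm ip (A x) \<le> C * nrm ip x"
    using bounded_op_bound[OF bA] by blast
  have a_le: "nrm a x \<le> sqrt C * nrm ip x" if x: "x \<in> V" for x
  proof -
    have "(nrm a x)\<^sup>2 \<le> cmod (ip (A x) x)"
      using a.nrm_power2[OF x] complex_Re_le_cmod[of "ip (A x) x"] by (simp add: a_def)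
    also have "\<dots> \<le> nrm ip (A x) * nrm ip x" using form_Cauchy_Schwarz AV x by blast
    also have "\<dots> \<le> C * nrm ip x * nrm ip x" using C(2)[OF x] x by (simp add: mult_right_mono)
    also have "\<dots> = (sqrt C * nrm ip x)\<^sup>2" using C(1) by (simp add: power2_eq_square)
    finally show ?thesis using x C(1) by (simp add: power2_le_iff_abs_le)
  qed
  \<comment> \<open>Only basis vectors with nonzero diagonal value have to be eliminated, and
    summability makes them countably many, so that they can be enumerated. The inserted 0 keeps
    \<open>P\<close> nonempty for \<open>from_nat_into\<close>.\<close>
  define P where "P = insert 0 {e \<in> E. Re (a e e) \<noteq> 0}"
  have "countable P"
    unfolding P_def using summable_countable_real[OF sm] by (simp add: a_def)
  then have range_e: "range (from_nat_into P) = P" by (simp add: P_def range_from_nat_into)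
  define e where "e = from_nat_into P"
  have e_in: "e n \<in> V" for n
  proof -
    have "e n \<in> P" using range_e unfolding e_def by blast
    then show ?thesis using EV by (auto simp: P_def)
  qed
  define Q where "Q = a.cholesky e"
  define g where "g = a.cholesky_vector e"
  have QV: "\<And>n x. x \<in> V \<Longrightarrow> Q n x \<in> V" unfolding Q_def using a.cholesky_in[OF e_in] .
  have gV: "\<And>k. g k \<in> V" unfolding g_def using a.cholesky_vector_in[OF e_in] .
  define \<phi> where "\<phi> k x = a x (g k)" for k x
  have \<phi>_ip: "\<phi> k x = ip x (A (g k))" if x: "x \<in> V" for k x
    using a.form_cnj[OF gV[of k] x] form_cnj[OF AV[OF gV[of k]] x] by (simp add: \<phi>_def a_def)
  have T_eq_A: "nrm ip (T x) = nrm ip (A x)" if x: "x \<in> V" for x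
  proof -
    have "ip (T x) (T x) = a (A x) x" using sq[OF x x] by (simp add: a_def)
    also have "\<dots> = ip (A x) (A x)"
      using a.form_cnj[OF x AV[OF x]] form_cnj[OF AV[OF x] AV[OF x]] by (simp add: a_def)
    finally show ?thesis by (simp add: nrm_def)
  qed
  define r where "r n x = nrm (a.residual e n) x" for n x
  have R: "positive_form_on scale V (a.residual e n)" for n
    by (rule a.positive_form_residual[OF e_in])
  have r_power2: "(r n x)\<^sup>2 = Re (a.residual e n x x)" if "x \<in> V" for n x
    unfolding r_def using positive_form_on.nrm_power2[OF R that] .
  have r_nonneg: "0 \<le> r n x" if "x \<in> V" for n x
    unfolding r_def using positive_form_on.nrm_nonneg[OF R that] .
  have r_antimono: "r n x \<le> r m x" if "x \<in> V" "m \<le> n" for m n x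
    unfolding r_def nrm_def using a.residual_self_antimono[OF e_in that] by simp
  have r_le: "r n x \<le> sqrt C * nrm ip x" if x: "x \<in> V" for n x
    using r_antimono[OF x, of 0 n] a_le[OF x] by (simp add: r_def a.residual_0[OF e_in])
  \<comment> \<open>A basis vector outside \<open>P\<close> is null for the form from the start; one
    in \<open>P\<close> becomes null after its turn in the enumeration.\<close>
  have r_basis: "\<exists>N. \<forall>n\<ge>N. r n f = 0" if f: "f \<in> E" for f
  proof (cases "Re (a f f) = 0")
    case True
    have "r n f \<le> 0" for n
      using r_antimono[OF EV[OF f], of 0 n] True
      by (simp add: r_def nrm_def a.residual_0[OF e_in])
    then show ?thesis using r_nonneg[OF EV[OF f]] by (meson antisym)
  next
    case False
    then have "f \<in> P" using f by (simp add: P_def)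
    then obtain k where k: "f = e k" using range_e unfolding e_def by blast
    have "r (Suc k) f = 0"
      unfolding r_def nrm_def k using a.residual_pivot[OF e_in] by simp
    then have "r n f = 0" if "n \<ge> Suc k" for n
      using r_antimono[OF EV[OF f] that] r_nonneg[OF EV[OF f]] by (simp add: antisym)
    then show ?thesis by blast
  qed
  have r_span: "\<exists>N. \<forall>n\<ge>N. r n x = 0" if "x \<in> span E" for x
  proof -
    have "x \<in> V \<and> (\<exists>N. \<forall>n\<ge>N. r n x = 0)"
      using that
    proof (induction rule: span_induct_alt)
      case base
      then show ?case
        unfolding r_def using positive_form_on.nrm_zero[OF R] by simp
    next
      case (step c f y)
      obtain M where M: "\<And>n. n \<ge> M \<Longrightarrow> r n f = 0" using r_basis[OF step(1)] by blast
      obtain N where N: "\<And>n. n \<ge> N \<Longrightarrow> r n y = 0" using step(2) by blast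
      have V: "f \<in> V" "y \<in> V" using step EV by auto
      have "r n (scale c f + y) = 0" if n: "n \<ge> max M N" for n
      proof -
        interpret R: positive_form_on scale V "a.residual e n" by (rule R)
        have "r n (scale c f + y) \<le> cmod c * r n f + r n y"
          using R.nrm_triangle[of "scale c f" y] V by (simp add: r_def R.nrm_scale)
        then show ?thesis using M N n r_nonneg[of "scale c f + y" n] V by simp
      qed
      then show ?case using V by (intro conjI exI[of _ "max M N"]) simp_all
    qed
    then show ?thesis ..
  qed
  have r_lim: "(\<lambda>n. r n x) \<longlonglongrightarrow> 0" if x: "x \<in> V" for x
  proof (rule LIMSEQ_I)
    fix \<epsilon> :: real assume \<epsilon>: "\<epsilon> > 0"
    then have "0 < \<epsilon> / (sqrt C + 1)" using C(1) by (simp add: add_nonneg_pos)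
    then obtain y where y: "y \<in> span E" "nrm ip (x - y) < \<epsilon> / (sqrt C + 1)"
      using dense x unfolding dense_in_def by blast
    have yV: "y \<in> V"
      using y(1) EV span_minimal[OF _ subspace_V, of E] by blast
    obtain N where N: "\<And>n. n \<ge> N \<Longrightarrow> r n y = 0" using r_span[OF y(1)] by blast
    have "norm (r n x - 0) < \<epsilon>" if n: "n \<ge> N" for n
    proof -
      interpret R: positive_form_on scale V "a.residual e n" by (rule R)
      have "r n x \<le> r n y + r n (x - y)"
        unfolding r_def by (rule R.nrm_triangle_sub[OF x yV])
      also have "\<dots> \<le> sqrt C * nrm ip (x - y)" using N[OF n] r_le[of "x - y" n] x yV by simp
      also have "\<dots> \<le> (sqrt C + 1) * nrm ip (x - y)" using x yV by (simp add: algebra_simps)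
      also have "\<dots> < \<epsilon>" using y(2) C(1) by (simp add: pos_less_divide_eq add_nonneg_pos mult.commute)
      finally show ?thesis using r_nonneg[OF x] by simp
    qed
    then show "\<exists>N. \<forall>n\<ge>N. norm (r n x - 0) < \<epsilon>" by blast
  qed
  \<comment> \<open>This passes from the seminorms \<open>r n\<close> to the norm:
    \<open>A (Q n x)\<close> is tested against itself, and its inner product with \<open>?z\<close>
    is a value of the residual form, which obeys Cauchy--Schwarz. By \<open>T_eq_A\<close> the bound
    also holds for \<open>T (Q n x)\<close>, the error of the partial expansion.\<close>
  have AQ_le: "nrm ip (A (Q n x)) \<le> sqrt C * r n x" if x: "x \<in> V" for n x
  proof -
    interpret R: positive_form_on scale V "a.residual e n" by (rule R)
    let ?z = "A (Q n x)"
    have z: "?z \<in> V" using AV QV x by simp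
    have "nrm ip ?z * nrm ip ?z = cmod (ip ?z ?z)"
      unfolding form_self[OF z] norm_of_real by (simp add: power2_eq_square)
    also have "ip ?z ?z = a.residual e n x ?z"
      by (simp add: a.residual_def a_def Q_def)
    also have "cmod \<dots> \<le> r n x * r n ?z"
      unfolding r_def by (rule R.form_Cauchy_Schwarz[OF x z])
    also have "\<dots> \<le> r n x * (sqrt C * nrm ip ?z)"
      using r_le[OF z] r_nonneg[OF x] by (rule mult_left_mono)
    finally have "nrm ip ?z * nrm ip ?z \<le> (sqrt C * r n x) * nrm ip ?z" by (simp add: mult_ac)
    then show ?thesis
      using nrm_nonneg[OF z] r_nonneg[OF x, of n] C(1)
      by (cases "nrm ip ?z = 0") (simp_all add: mult_le_cancel_right)
  qed
  have partial: "T x - (\<Sum>k<n. scale (\<phi> k x) (T (g k))) = T (Q n x)" if x: "x \<in> V" for n x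
  proof -
    have "T (Q n x) = T (x - (\<Sum>k<n. scale (\<phi> k x) (g k)))"
      unfolding Q_def \<phi>_def g_def a.cholesky_telescope[OF e_in x] ..
    then show ?thesis
      using x gV by (simp add: bounded_op_diff[OF bT] bounded_op_sum[OF bT] bounded_op_scale[OF bT])
  qed
  define c where "c k = nrm ip (A (g k))" for k
  have \<phi>_bound: "functional_bound (\<phi> k) (c k)" for k
    using functional_bound_ip[OF AV[OF gV[of k]]] \<phi>_ip
    unfolding functional_bound_def c_def by (auto simp: subspace_V)
  \<comment> \<open>Parseval writes each square as a sum over \<open>E\<close>. For a fixed basis
    vector \<open>f\<close> the sum over \<open>k\<close> is at most \<open>a f f\<close>, since the
    residual is nonnegative.\<close>
  have sum_c: "(\<Sum>k<n. (c k)\<^sup>2) \<le> (\<Sum>\<^sub>\<infinity>e\<in>E. Re (a e e))" for n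
  proof -
    have "((\<lambda>f. (cmod (\<phi> k f))\<^sup>2) has_sum (c k)\<^sup>2) E" for k
    proof -
      have h: "A (g k) \<in> V" using AV gV by simp
      have "((\<lambda>f. ip (A (g k)) f * ip f (A (g k))) has_sum ip (A (g k)) (A (g k))) E"
        by (rule functional_Fourier[OF E functional_bound_ip[OF h] h])
      then have "((\<lambda>f. Re (ip (A (g k)) f * ip f (A (g k)))) has_sum Re (ip (A (g k)) (A (g k)))) E"
        by (rule has_sum_Re)
      moreover have "Re (ip (A (g k)) f * ip f (A (g k))) = (cmod (\<phi> k f))\<^sup>2" if "f \<in> E" for f
      proof -
        have "ip (A (g k)) f = cnj (ip f (A (g k)))" using form_cnj[OF EV[OF that] h] .
        then have "ip (A (g k)) f * ip f (A (g k)) = of_real ((cmod (ip f (A (g k))))\<^sup>2)"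
          by (simp only: complex_norm_square mult.commute)
        then show ?thesis using \<phi>_ip[OF EV[OF that]] by simp
      qed
      moreover have "Re (ip (A (g k)) (A (g k))) = (c k)\<^sup>2"
        unfolding c_def by (simp add: nrm_power2[OF h])
      ultimately show ?thesis
        using has_sum_cong[of E "\<lambda>f. Re (ip (A (g k)) f * ip f (A (g k)))"] by simp
    qed
    then have "((\<lambda>f. \<Sum>k<n. (cmod (\<phi> k f))\<^sup>2) has_sum (\<Sum>k<n. (c k)\<^sup>2)) E"
      by (induction n) (simp_all add: has_sum_add)
    moreover have "((\<lambda>f. Re (a f f)) has_sum (\<Sum>\<^sub>\<infinity>e\<in>E. Re (a e e))) E"
      using sm by (intro has_sum_infsum) (simp add: a_def)
    moreover have "(\<Sum>k<n. (cmod (\<phi> k f))\<^sup>2) \<le> Re (a f f)" if "f \<in> E" for f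
      unfolding \<phi>_def g_def a.sum_form_cholesky_vector[OF e_in EV[OF that]]
      using a.residual_self_nonneg[OF e_in EV[OF that]] by simp
    ultimately show ?thesis by (rule has_sum_mono)
  qed
  have summ: "summable (\<lambda>k. (c k)\<^sup>2)"
    by (rule summableI_nonneg_bounded[OF _ sum_c]) simp
  have Tg: "nrm ip (T (g k)) = c k" for k unfolding c_def using T_eq_A gV by simp
  have "nuclear_rep UNIV \<phi> (\<lambda>k. T (g k)) c T"
  proof (rule nuclear_repI)
    show "(\<lambda>k. c k * nrm ip (T (g k))) summable_on UNIV"
      using summ by (subst summable_on_UNIV_nonneg_real_iff) (simp_all add: Tg power2_eq_square)
    fix x \<psi> d assume x: "x \<in> V" and \<psi>: "functional_bound \<psi> d"
    have d: "0 \<le> d" using \<psi> by (rule functional_bound_nonneg)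
    show "((\<lambda>k. \<phi> k x * \<psi> (T (g k))) has_sum \<psi> (T x)) UNIV"
    proof (rule norm_summable_imp_has_sum)
      show "summable (\<lambda>k. norm (\<phi> k x * \<psi> (T (g k))))"
      proof (rule summable_comparison_test)
        have "norm (\<phi> k x * \<psi> (T (g k))) \<le> (c k * nrm ip x) * (d * c k)" for k
          unfolding norm_mult
          using functional_le[OF \<phi>_bound x] functional_le[OF \<psi> TV[OF gV[of k]]] x d
            functional_bound_nonneg[OF \<phi>_bound[of k]]
          by (intro mult_mono) (simp_all add: Tg)
        then have "norm (norm (\<phi> k x * \<psi> (T (g k)))) \<le> (nrm ip x * d) * (c k)\<^sup>2" for k
          by (simp add: power2_eq_square mult_ac)
        then show "\<exists>N. \<forall>k\<ge>N. norm (norm (\<phi> k x * \<psi> (T (g k)))) \<le> (nrm ip x * d) * (c k)\<^sup>2"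
          by blast
        show "summable (\<lambda>k. (nrm ip x * d) * (c k)\<^sup>2)" using summ by (rule summable_mult)
      qed
      have "norm ((\<Sum>k<n. \<phi> k x * \<psi> (T (g k))) - \<psi> (T x)) \<le> (d * sqrt C) * r n x" for n
      proof -
        have "(\<Sum>k<n. \<phi> k x * \<psi> (T (g k))) = \<psi> (\<Sum>k<n. scale (\<phi> k x) (T (g k)))"
          using TV gV by (simp add: functional_sum[OF \<psi>] functional_scale[OF \<psi>])
        then have "norm ((\<Sum>k<n. \<phi> k x * \<psi> (T (g k))) - \<psi> (T x)) = norm (\<psi> (T (Q n x)))"
          unfolding partial[OF x, symmetric] using x TV gV
          by (simp add: functional_diff[OF \<psi>] norm_minus_commute)
        also have "\<dots> \<le> d * nrm ip (T (Q n x))"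
          using x by (intro functional_le[OF \<psi>] TV QV)
        also have "\<dots> \<le> d * (sqrt C * r n x)"
          using AQ_le[OF x, of n] T_eq_A[OF QV[OF x, of n]] d by (intro mult_left_mono) simp_all
        finally show ?thesis by (simp add: mult.assoc)
      qed
      moreover have "(\<lambda>n. (d * sqrt C) * r n x) \<longlonglongrightarrow> 0"
        using tendsto_mult_right_zero[OF r_lim[OF x]] .
      ultimately have "(\<lambda>n. (\<Sum>k<n. \<phi> k x * \<psi> (T (g k))) - \<psi> (T x)) \<longlonglongrightarrow> 0"
        by (rule Lim_null_comparison[OF always_eventually[OF allI]])
      then show "(\<lambda>k. \<phi> k x * \<psi> (T (g k))) sums \<psi> (T x)"
        unfolding sums_def by (rule LIM_zero_cancel)
    qed
  qed (use TV gV \<phi>_bound in auto)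
  then show ?thesis using gV by blast
qed

end

section \<open>Tame operators\<close>

context hilbert_scale
begin

lemma tame_operator_linear: "tame_operator T \<Longrightarrow> Vector_Spaces.linear scale scale T"
  unfolding tame_operator_def tame_def by blast

lemma tame_operator_add: "tame_operator T \<Longrightarrow> T (x + y) = T x + T y"
  and tame_operator_scale: "tame_operator T \<Longrightarrow> T (scale c x) = scale c (T x)"
  using tame_operator_linear unfolding Vector_Spaces.linear_iff by blast+

lemma tame_operator_diff: "tame_operator T \<Longrightarrow> T (x - y) = T x - T y"
  using tame_operator_add[of T "x - y" y] by simp

lemma tame_operator_zero: "tame_operator T \<Longrightarrow> T 0 = 0"
  using tame_operator_diff[of T 0 0] by simp

lemma tame_comp:
  assumes S: "tame m S" and T: "tame n T"
  shows "tame (n + m) (\<lambda>x. S (T x))"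
  unfolding tame_def
proof (intro conjI allI)
  have "tame_operator S" "tame_operator T" using S T unfolding tame_operator_def by blast+
  then show "Vector_Spaces.linear scale scale (\<lambda>x. S (T x))"
    using tame_operator_linear[of T] unfolding Vector_Spaces.linear_iff
    by (simp add: tame_operator_add tame_operator_scale)
  fix s
  have eq: "s - n - m = s - (n + m)" by simp
  have TH: "T ` H s \<subseteq> H (s - n)" and SH: "S ` H (s - n) \<subseteq> H (s - (n + m))"
    using S T unfolding tame_def eq[symmetric] by blast+
  then show "(\<lambda>x. S (T x)) ` H s \<subseteq> H (s - (n + m))" by blast
  obtain C where C: "\<And>x. x \<in> H s \<Longrightarrow> nrm (ip (s - n)) (T x) \<le> C * nrm (ip s) x"
    using T unfolding tame_def by blast
  obtain D where D: "\<And>x. x \<in> H (s - n) \<Longrightarrow> nrm (ip (s - (n + m))) (S x) \<le> D * nrm (ip (s - n)) x"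
    using S unfolding tame_def eq[symmetric] by blast
  interpret Hn: hilbert_space_on scale "H (s - n)" "ip (s - n)" by (rule hilbert)
  have "nrm (ip (s - (n + m))) (S (T x)) \<le> (\<bar>D\<bar> * C) * nrm (ip s) x" if x: "x \<in> H s" for x
  proof -
    have Tx: "T x \<in> H (s - n)" using TH x by blast
    have "nrm (ip (s - (n + m))) (S (T x)) \<le> D * nrm (ip (s - n)) (T x)" using D[OF Tx] .
    also have "\<dots> \<le> \<bar>D\<bar> * nrm (ip (s - n)) (T x)"
      using Hn.nrm_nonneg[OF Tx] by (intro mult_right_mono) simp_all
    also have "\<dots> \<le> \<bar>D\<bar> * (C * nrm (ip s) x)" using C[OF x] by (intro mult_left_mono) simp_all
    finally show ?thesis by (simp add: mult.assoc)
  qed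
  then show "\<exists>C. \<forall>x\<in>H s. nrm (ip (s - (n + m))) (S (T x)) \<le> C * nrm (ip s) x" by blast
qed

lemma tame_operator_comp:
  "\<lbrakk>tame_operator S; tame_operator T\<rbrakk> \<Longrightarrow> tame_operator (\<lambda>x. S (T x))"
  unfolding tame_operator_def using tame_comp by blast

lemma H_inf_in: "x \<in> H_inf \<Longrightarrow> x \<in> H s"
  unfolding H_inf_def by blast

lemma subspace_H: "subspace (H s)"
  using hilbert by (rule hilbert_space_on.subspace_V)

lemma subspace_H_inf: "subspace H_inf"
  unfolding H_inf_def using subspace_H by (rule subspace_Int)

lemma tame_operator_H_inf:
  assumes T: "tame_operator T" and x: "x \<in> H_inf"
  shows "T x \<in> H_inf"
proof -
  obtain m where m: "tame m T" using T unfolding tame_operator_def by blast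
  have "T x \<in> H s" for s
  proof -
    have "T ` H (s + m) \<subseteq> H (s + m - m)" using m unfolding tame_def by blast
    then show ?thesis using H_inf_in[OF x, of "s + m"] by auto
  qed
  then show ?thesis unfolding H_inf_def by blast
qed

lemma smoothing_in_H_inf: "smoothing K \<Longrightarrow> K x \<in> H_inf"
  unfolding smoothing_def by blast

lemma smoothing_comp_left:
  assumes "tame_operator S" "smoothing K"
  shows "smoothing (\<lambda>x. S (K x))"
  using assms tame_operator_H_inf[OF assms(1)] tame_operator_comp[of S K]
  unfolding smoothing_def by auto

lemma smoothing_comp:
  assumes "tame_operator S" "smoothing K" "tame_operator T"
  shows "smoothing (\<lambda>x. S (K (T x)))"
proof (rule smoothing_comp_left[OF assms(1)])
  show "smoothing (\<lambda>x. K (T x))"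
    using assms tame_operator_comp[of K T] unfolding smoothing_def by auto
qed

end

section \<open>Bounded operators on \<open>H 0\<close> and the graph domain of a tame
  operator\<close>

context tame_setting
begin

sublocale H0: hilbert_space_on scale "H 0" "ip 0"
  by (rule hilbert)

lemma tame_0_bounded_op:
  assumes "tame 0 T"
  shows "H0.bounded_op T"
proof -
  have "tame_operator T" using assms unfolding tame_operator_def by blast
  moreover have "T ` H 0 \<subseteq> H 0" "\<exists>C. \<forall>x\<in>H 0. nrm (ip 0) (T x) \<le> C * nrm (ip 0) x"
    using assms unfolding tame_def by (metis diff_0_right)+
  ultimately show ?thesis
    unfolding H0.bounded_op_def linear_on_def
    by (simp add: tame_operator_add tame_operator_scale)
qed

text \<open>Tameness of order m by itself gives only a bounded map from \<open>H 0\<close> to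
  \<open>H (- m)\<close>; the bound on \<open>H 0\<close> comes from the trace class
  assumption.\<close>

lemma smoothing_bounded_op: "smoothing K \<Longrightarrow> H0.bounded_op K"
  using smoothing_trace_class[of K 0] unfolding H0.trace_class_def by blast

lemma smoothing_nuclear_rep:
  assumes "smoothing K"
  shows "\<exists>(\<phi> :: nat \<Rightarrow> 'a \<Rightarrow> complex) g c.
    H0.nuclear_rep UNIV \<phi> (\<lambda>k. K (g k)) c K \<and> (\<forall>k. g k \<in> H 0)"
  using H0.trace_class_nuclear_rep[OF smoothing_trace_class[OF assms]] .

lemma H_inf_approximation:
  assumes "x \<in> H 0"
  shows "\<exists>X. range X \<subseteq> H_inf \<and> converges_in (H 0) (ip 0) X x"
proof -
  have "\<exists>y\<in>H_inf. nrm (ip 0) (x - y) < inverse (real (Suc n))" for n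
    using H_inf_dense[of 0] assms unfolding dense_in_def by auto
  then obtain X where X: "\<And>n. X n \<in> H_inf" "\<And>n. nrm (ip 0) (x - X n) < inverse (real (Suc n))"
    by metis
  have XH: "X n \<in> H 0" for n using H_inf_in[OF X(1)] .
  have "(\<lambda>n. nrm (ip 0) (X n - x)) \<longlonglongrightarrow> 0"
  proof (rule tendsto_sandwich[OF _ _ tendsto_const LIMSEQ_inverse_real_of_nat])
    show "\<forall>\<^sub>F n in sequentially. nrm (ip 0) (X n - x) \<le> inverse (real (Suc n))"
      using X(2) H0.nrm_diff_commute[OF assms XH] by (intro always_eventually allI) (simp add: less_imp_le)
  qed (simp add: XH assms)
  then show ?thesis using X(1) XH assms by (intro exI[of _ X]) (auto simp: converges_in_def)
qed

lemma Dom0_H_inf: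
  assumes "tame_operator U" "x \<in> H_inf"
  shows "x \<in> Dom0 U"
  unfolding Dom0_def mem_Collect_eq
  using assms H_inf_in[OF assms(2), of 0] H_inf_in[OF tame_operator_H_inf[OF assms], of 0]
  by (intro exI[of _ "\<lambda>_. x"]) (auto intro: H0.converges_in_const)

lemma Dom0_D:
  assumes "x \<in> Dom0 U"
  shows "x \<in> H 0" "U x \<in> H 0"
  using assms unfolding Dom0_def converges_in_def by auto

lemma Dom0_add:
  assumes U: "tame_operator U" and "x \<in> Dom0 U" "y \<in> Dom0 U"
  shows "x + y \<in> Dom0 U"
proof -
  obtain X Y where X: "range X \<subseteq> H_inf" "converges_in (H 0) (ip 0) X x"
      "converges_in (H 0) (ip 0) (\<lambda>n. U (X n)) (U x)"
    and Y: "range Y \<subseteq> H_inf" "converges_in (H 0) (ip 0) Y y"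
      "converges_in (H 0) (ip 0) (\<lambda>n. U (Y n)) (U y)"
    using assms unfolding Dom0_def by blast
  have "range (\<lambda>n. X n + Y n) \<subseteq> H_inf"
    using X(1) Y(1) subspace_add[OF subspace_H_inf] by blast
  then show ?thesis
    unfolding Dom0_def mem_Collect_eq
    using H0.converges_in_add[OF X(2) Y(2)] H0.converges_in_add[OF X(3) Y(3)]
    by (intro exI[of _ "\<lambda>n. X n + Y n"]) (simp add: tame_operator_add[OF U])
qed

end

section \<open>The index of a tame Fredholm pair\<close>

locale fredholm_pair_setting = tame_setting scale H ip
  for scale :: "complex \<Rightarrow> 'a::ab_group_add \<Rightarrow> 'a"
    and H :: "real \<Rightarrow> 'a set" and ip :: "real \<Rightarrow> 'a \<Rightarrow> 'a \<Rightarrow> complex" +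
  fixes P R U K1 K2 :: "'a \<Rightarrow> 'a"
  assumes pair: "tame_fredholm_pair P R"
    and param: "parametrix (pair_op P R) U K1 K2"
begin

section \<open>Algebra of \<open>A\<close> and \<open>B\<close> modulo smoothing operators\<close>

lemma projections:
  shows P_tame0: "tame 0 P" and R_tame0: "tame 0 R"
    and P_idem [simp]: "P (P x) = P x" and R_idem [simp]: "R (R x) = R x"
proof -
  have *: "tame 0 P" "P \<circ> P = P" "tame 0 R" "R \<circ> R = R"
    using pair unfolding tame_fredholm_pair_def tame_projection_def by blast+
  show "tame 0 P" "tame 0 R" by (fact *)+
  show "P (P x) = P x" "R (R x) = R x"
    using fun_cong[OF *(2), of x] fun_cong[OF *(4), of x] by simp_all
qed

lemma tame_ops: "tame_operator P" "tame_operator R" "tame_operator U"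
  and smoothing_K: "smoothing K1" "smoothing K2"
  and TU: "pair_op P R (U x) = x - K1 x" and UT: "U (pair_op P R x) = x - K2 x"
  using P_tame0 R_tame0 param unfolding parametrix_def tame_operator_def by blast+

lemmas op_simps = tame_ops[THEN tame_operator_add] tame_ops[THEN tame_operator_diff]
  tame_ops[THEN tame_operator_scale] tame_ops[THEN tame_operator_zero]

lemma range_P_iff: "x \<in> range P \<longleftrightarrow> P x = x"
  by (metis P_idem rangeE rangeI)

lemma range_R_iff: "x \<in> range R \<longleftrightarrow> R x = x"
  by (metis R_idem rangeE rangeI)

definition A :: "'a \<Rightarrow> 'a" where "A x = R (P x)"
definition B :: "'a \<Rightarrow> 'a" where "B x = P (U (R x))"
definition S1 :: "'a \<Rightarrow> 'a" where "S1 x = R (K1 (R x))"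
definition S2 :: "'a \<Rightarrow> 'a" where "S2 x = P (K2 (P x))"

lemma pair_op_P: "pair_op P R (P x) = A x"
  by (simp add: pair_op_def A_def op_simps)

lemma R_pair_op: "R (pair_op P R x) = A x"
  by (simp add: pair_op_def A_def op_simps)

lemma A_P [simp]: "A (P x) = A x" and R_A [simp]: "R (A x) = A x"
  and S1_R [simp]: "S1 (R x) = S1 x" and R_S1 [simp]: "R (S1 x) = S1 x"
  and P_S2 [simp]: "P (S2 x) = S2 x" and P_B [simp]: "P (B x) = B x"
  by (simp_all add: A_def S1_def S2_def B_def)

lemma A_B: "A (B y) = R y - S1 y"
proof -
  have "A (B y) = R (pair_op P R (U (R y)))" by (simp add: R_pair_op B_def)
  then show ?thesis by (simp add: TU S1_def op_simps)
qed

lemma B_A: "B (A x) = P x - S2 x"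
proof -
  have "B (A x) = P (U (pair_op P R (P x)))" by (simp add: pair_op_P B_def)
  then show ?thesis by (simp add: UT S2_def op_simps)
qed

lemma tame_A: "tame_operator A" and tame_B: "tame_operator B"
  unfolding A_def[abs_def] B_def[abs_def]
  by (rule tame_operator_comp[OF tame_ops(2,1)],
      rule tame_operator_comp[OF tame_ops(1) tame_operator_comp[OF tame_ops(3,2)]])

lemma smoothing_S1: "smoothing S1" and smoothing_S2: "smoothing S2"
  unfolding S1_def[abs_def] S2_def[abs_def]
  by (rule smoothing_comp[OF tame_ops(2) smoothing_K(1) tame_ops(2)],
      rule smoothing_comp[OF tame_ops(1) smoothing_K(2) tame_ops(1)])

lemmas A_simps = tame_A[THEN tame_operator_add] tame_A[THEN tame_operator_diff]
  tame_A[THEN tame_operator_scale] tame_A[THEN tame_operator_zero]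

lemmas B_simps = tame_B[THEN tame_operator_add] tame_B[THEN tame_operator_diff]
  tame_B[THEN tame_operator_scale] tame_B[THEN tame_operator_zero]

lemma A_S2: "A (S2 x) = S1 (A x)"
proof -
  have "A x - A (S2 x) = A (B (A x))" by (simp add: B_A A_simps)
  also have "\<dots> = A x - S1 (A x)" by (simp add: A_B)
  finally show ?thesis by simp
qed

lemmas bounded_P = tame_0_bounded_op[OF P_tame0]
  and bounded_R = tame_0_bounded_op[OF R_tame0]
  and bounded_S1 = smoothing_bounded_op[OF smoothing_S1]
  and bounded_S2 = smoothing_bounded_op[OF smoothing_S2]

text \<open>There is no counterpart for \<open>B\<close>, because the order of \<open>U\<close> may
  be positive.\<close>

lemma bounded_A: "H0.bounded_op A"
  unfolding A_def[abs_def] by (rule H0.bounded_op_comp[OF bounded_R bounded_P])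

definition X :: "'a set" where "X = H_inf \<inter> range P"
definition Y :: "'a set" where "Y = H_inf \<inter> range R"

lemma subspace_range: "tame_operator T \<Longrightarrow> subspace (range T)"
proof -
  assume "tame_operator T"
  interpret pair: vector_space_pair scale scale ..
  show ?thesis
    using pair.linear_subspace_image[OF tame_operator_linear[OF \<open>tame_operator T\<close>] subspace_UNIV] .
qed

lemma subspace_X: "subspace X" and subspace_Y: "subspace Y"
  unfolding X_def Y_def
  by (rule subspace_inter[OF subspace_H_inf subspace_range[OF tame_ops(1)]],
      rule subspace_inter[OF subspace_H_inf subspace_range[OF tame_ops(2)]])

lemma X_iff: "x \<in> X \<longleftrightarrow> x \<in> H_inf \<and> P x = x" and Y_iff: "x \<in> Y \<longleftrightarrow> x \<in> H_inf \<and> R x = x"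
  unfolding X_def Y_def by (auto simp: range_P_iff range_R_iff)

lemma B_Y: "y \<in> H_inf \<Longrightarrow> B y \<in> X"
  using tame_operator_H_inf[OF tame_B] by (simp add: X_iff)

lemma S1_Y: "S1 x \<in> Y" and S2_X: "S2 x \<in> X"
  using smoothing_in_H_inf[OF smoothing_S1] smoothing_in_H_inf[OF smoothing_S2]
  by (simp_all add: X_iff Y_iff)

text \<open>Elliptic regularity: \<open>U\<close> preserves smoothness and \<open>K2\<close> has
  smooth values, so \<open>x\<close> is smooth whenever \<open>y\<close> is.\<close>

lemma preimage_eq:
  assumes "P x = x" "A x = y"
  shows "x = U y + K2 x"
  using UT[of x] pair_op_P[of x] assms by simp

definition N :: "'a set" where "N = {x \<in> H 0 \<inter> range P. A x = 0}"

lemma N_in_H_inf: "x \<in> N \<Longrightarrow> x \<in> H_inf \<and> K2 x = x"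
proof -
  assume "x \<in> N"
  then have "x = K2 x"
    using preimage_eq[of x 0] by (simp add: N_def range_P_iff op_simps)
  then show ?thesis using smoothing_in_H_inf[OF smoothing_K(2), of x] by simp
qed

text \<open>\<open>K2\<close> is the identity on \<open>N\<close>. For a finite-rank
  \<open>?F\<close> within 1/2 of \<open>K2\<close>, \<open>?F x = 0\<close> forces
  \<parallel>x\<parallel> \<le> \<parallel>x\<parallel> / 2, so \<open>?F\<close> embeds
  \<open>N\<close> into a finite-dimensional space.\<close>

lemma finite_dim_N: "\<exists>F. finite F \<and> span F = N"
proof -
  interpret pair: vector_space_pair scale scale ..
  obtain \<phi> :: "nat \<Rightarrow> 'a \<Rightarrow> complex" and g c
    where rep: "H0.nuclear_rep UNIV \<phi> (\<lambda>k. K2 (g k)) c K2"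
    using smoothing_nuclear_rep[OF smoothing_K(2)] by blast
  obtain J where J: "finite J"
    "\<And>x. x \<in> H 0 \<Longrightarrow> nrm (ip 0) (K2 x - (\<Sum>k\<in>J. scale (\<phi> k x) (K2 (g k)))) \<le> 1 / 2 * nrm (ip 0) x"
    using H0.nuclear_rep_split[OF rep, of "1 / 2"] by auto
  let ?F = "\<lambda>x. \<Sum>k\<in>J. scale (\<phi> k x) (K2 (g k))"
  have "H0.bounded_op ?F"
    using H0.nuclear_repD(2,3)[OF rep] by (intro H0.bounded_op_finite_rank) auto
  then have "linear_on (H 0) ?F" unfolding H0.bounded_op_def by blast
  from linear_on_extend[OF subspace_H this]
  obtain f where f: "Vector_Spaces.linear scale scale f" "\<And>x. x \<in> H 0 \<Longrightarrow> f x = ?F x"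
    by blast
  have subN: "subspace N"
  proof -
    have "N = (H 0 \<inter> range P) \<inter> {x. A x = 0}" by (auto simp: N_def)
    then show ?thesis
      using subspace_inter[OF subspace_inter[OF subspace_H[of 0] subspace_range[OF tame_ops(1)]]
          pair.linear_subspace_kernel[OF tame_operator_linear[OF tame_A]]] by simp
  qed
  have "x = 0" if x: "x \<in> N" "f x = 0" for x
  proof -
    have xH: "x \<in> H 0" using x(1) by (simp add: N_def)
    then have "nrm (ip 0) x \<le> 1 / 2 * nrm (ip 0) x"
      using J(2)[OF xH] N_in_H_inf[OF x(1)] f(2)[OF xH] x(2) by simp
    then show ?thesis using H0.nrm_le_0D[OF xH] by simp
  qed
  then have ker: "{x \<in> N. f x = 0} \<subseteq> span {}" by auto
  have "?F x \<in> span ((\<lambda>k. K2 (g k)) ` J)" for x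
    by (intro span_sum span_scale span_base) simp
  then have "f ` N \<subseteq> span ((\<lambda>k. K2 (g k)) ` J)"
    using f(2) by (auto simp: N_def)
  then show ?thesis
    using pair.rank_nullity_on(1)[OF f(1) subN _ ker] J(1) by blast
qed

text \<open>The corrected parametrix \<open>B + D\<close>, \<open>D = B G (Id - G)\<^sup>-\<^sup>1 R\<close>, where \<open>G\<close> is \<open>S1\<close> minus an
  approximation of finite rank: it inverts \<open>A\<close> on the right up to a finite-rank operator.\<close>

lemma finite_rank_correction:
  "\<exists>D C t. H0.bounded_op D \<and> (\<forall>x\<in>H 0. D x \<in> X) \<and>
     H0.has_trace (\<lambda>x. A (D x)) t \<and> H0.has_trace (\<lambda>x. D (A x)) t \<and>
     finite C \<and> C \<subseteq> Y \<and> (\<forall>x\<in>H 0. S1 x - A (D x) \<in> span C)"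
proof -
  obtain \<phi> :: "nat \<Rightarrow> 'a \<Rightarrow> complex" and g c
    where rep: "H0.nuclear_rep UNIV \<phi> (\<lambda>k. S1 (g k)) c S1"
    using smoothing_nuclear_rep[OF smoothing_S1] by blast
  have \<phi>: "\<And>k. H0.functional_bound (\<phi> k) (c k)"
    using H0.nuclear_repD(2)[OF rep] by simp
  obtain J where J: "finite J"
    "\<And>x. x \<in> H 0 \<Longrightarrow> nrm (ip 0) (S1 x - (\<Sum>k\<in>J. scale (\<phi> k x) (S1 (g k)))) \<le> 1 / 2 * nrm (ip 0) x"
    using H0.nuclear_rep_split[OF rep, of "1 / 2"] by auto
  \<comment> \<open>The vectors \<open>S1 (g k)\<close> lie in \<open>Y\<close>, so
    \<open>F\<close>, and with it \<open>G\<close>, takes values in smooth vectors fixed by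
    \<open>R\<close>.\<close>
  define F where "F x = (\<Sum>k\<in>J. scale (\<phi> k x) (S1 (g k)))" for x
  define G where "G x = S1 x - F x" for x
  have YH: "y \<in> H 0" if "y \<in> Y" for y using that H_inf_in by (simp add: Y_iff)
  have bF: "H0.bounded_op F"
    unfolding F_def[abs_def] using YH[OF S1_Y] by (intro H0.bounded_op_finite_rank[OF \<phi>])
  have bG: "H0.bounded_op G"
    unfolding G_def[abs_def] by (rule H0.bounded_op_diff_op[OF bounded_S1 bF])
  have "linear_on (H 0) G" "G ` H 0 \<subseteq> H 0" using bG unfolding H0.bounded_op_def by blast+
  from H0.Neumann_inverse[OF this, of "1 / 2"]
  obtain M where bM: "H0.bounded_op M" and M: "\<And>y. y \<in> H 0 \<Longrightarrow> M y - G (M y) = y"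
    "\<And>y. y \<in> H 0 \<Longrightarrow> M (G y) = G (M y)"
    using J(2) by (auto simp: G_def F_def)
  have F_span: "F x \<in> span ((\<lambda>k. S1 (g k)) ` J)" for x
    unfolding F_def using J(1) by (intro span_sum span_scale span_base) simp
  have "span ((\<lambda>k. S1 (g k)) ` J) \<subseteq> Y"
    using S1_Y subspace_Y by (intro span_minimal) auto
  then have GY: "G x \<in> Y" for x
    unfolding G_def using F_span S1_Y by (intro subspace_diff[OF subspace_Y]) auto
  define W where "W x = M (R x)" for x
  have bW: "H0.bounded_op W"
    unfolding W_def[abs_def] by (rule H0.bounded_op_comp[OF bM bounded_R])
  define D where "D x = B (G (W x))" for x
  have DX: "D x \<in> X" for x
    unfolding D_def using GY by (intro B_Y) (simp add: Y_iff)
  have XH: "x \<in> H 0" if "x \<in> X" for x using that H_inf_in by (simp add: X_iff)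

  \<comment> \<open>\<open>B\<close> may be unbounded, so composing it with the expansion of
    \<open>S1\<close> is not an option. Instead \<open>B S1\<close> is smoothing and has an
    expansion of its own, while \<open>B F\<close> has finite rank with smooth values;
    \<open>D\<close> is a difference of these two composed with the bounded
    \<open>W\<close>.\<close>
  have smBS: "smoothing (\<lambda>x. B (S1 x))"
    by (rule smoothing_comp_left[OF tame_B smoothing_S1])
  obtain \<phi>' :: "nat \<Rightarrow> 'a \<Rightarrow> complex" and g' c'
    where rep': "H0.nuclear_rep UNIV \<phi>' (\<lambda>k. B (S1 (g' k))) c' (\<lambda>x. B (S1 x))"
    using smoothing_nuclear_rep[OF smBS] by blast
  have BS1H: "B (S1 x) \<in> H 0" for x using XH B_Y S1_Y by (simp add: Y_iff)
  have rep'': "H0.nuclear_rep J \<phi> (\<lambda>k. B (S1 (g k))) c (\<lambda>x. \<Sum>k\<in>J. scale (\<phi> k x) (B (S1 (g k))))"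
    using J(1) \<phi> BS1H by (intro H0.nuclear_rep_finite)
  have B_F: "B (F x) = (\<Sum>k\<in>J. scale (\<phi> k x) (B (S1 (g k))))" for x
  proof -
    interpret pair: vector_space_pair scale scale ..
    show ?thesis
      unfolding F_def using tame_operator_linear[OF tame_B]
      by (simp add: pair.linear_sum pair.linear_scale)
  qed
  have bBF: "H0.bounded_op (\<lambda>x. B (F x))"
    unfolding B_F using BS1H by (intro H0.bounded_op_finite_rank[OF \<phi>])
  have D_eq: "D x = B (S1 (W x)) - B (F (W x))" for x
    by (simp add: D_def G_def B_simps)
  have bD1: "H0.bounded_op (\<lambda>x. B (S1 (W x)))" and bD2: "H0.bounded_op (\<lambda>x. B (F (W x)))"
    using H0.bounded_op_comp[OF smoothing_bounded_op[OF smBS] bW] H0.bounded_op_comp[OF bBF bW] .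
  have bD: "H0.bounded_op D"
    unfolding D_eq[abs_def] by (rule H0.bounded_op_diff_op[OF bD1 bD2])
  obtain c1 where "H0.nuclear_rep UNIV (\<lambda>k x. \<phi>' k (W x)) (\<lambda>k. B (S1 (g' k))) c1 (\<lambda>x. B (S1 (W x)))"
    using H0.nuclear_rep_comp_right[OF rep' bW] ..
  then obtain t1 where t1: "H0.has_trace (\<lambda>x. A (B (S1 (W x)))) t1"
      "H0.has_trace (\<lambda>x. B (S1 (W (A x)))) t1"
    using H0.nuclear_trace_commute[OF _ bounded_A] by blast
  obtain c2 where "H0.nuclear_rep J (\<lambda>k x. \<phi> k (W x)) (\<lambda>k. B (S1 (g k))) c2 (\<lambda>x. B (F (W x)))"
    using H0.nuclear_rep_comp_right[OF rep'' bW] unfolding B_F ..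
  then obtain t2 where t2: "H0.has_trace (\<lambda>x. A (B (F (W x)))) t2"
      "H0.has_trace (\<lambda>x. B (F (W (A x)))) t2"
    using H0.nuclear_trace_commute[OF _ bounded_A] by blast
  have trace: "\<exists>t. H0.has_trace (\<lambda>x. A (D x)) t \<and> H0.has_trace (\<lambda>x. D (A x)) t"
  proof (intro exI conjI)
    show "H0.has_trace (\<lambda>x. A (D x)) (t1 - t2)"
      unfolding D_eq A_simps
      using H0.has_trace_diff[OF t1(1) t2(1)] H0.bounded_op_in[OF bounded_A]
        H0.bounded_op_in[OF bD1] H0.bounded_op_in[OF bD2] by blast
    show "H0.has_trace (\<lambda>x. D (A x)) (t1 - t2)"
      unfolding D_eq
      using H0.has_trace_diff[OF t1(2) t2(2)] H0.bounded_op_in[OF bounded_A]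
        H0.bounded_op_in[OF bD1] H0.bounded_op_in[OF bD2] by blast
  qed
  have "S1 x - A (D x) \<in> span ((\<lambda>k. S1 (g k)) ` J)" if x: "x \<in> H 0" for x
  proof -
    have Rx: "R x \<in> H 0" using H0.bounded_op_in[OF bounded_R x] .
    have GR: "G (R x) \<in> H 0" using YH GY by blast
    \<comment> \<open>Commuting \<open>M\<close> past \<open>G\<close> gives
      \<open>?z - G ?z = G (R x)\<close>. Writing \<open>G\<close> as \<open>S1\<close> minus
      \<open>F\<close> and using that \<open>A B\<close> is Id minus \<open>S1\<close> on
      \<open>Y\<close>, only values of \<open>F\<close> remain.\<close>
    let ?z = "G (W x)"
    have z: "?z = M (G (R x))" using M(2)[OF Rx] by (simp add: W_def)
    have "?z - G ?z = G (R x)" unfolding z using M(1)[OF GR] .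
    then have "?z - S1 ?z = S1 x - F (R x) - F ?z" by (simp add: G_def algebra_simps)
    moreover have "A (D x) = ?z - S1 ?z"
      using GY[of "W x"] by (simp add: D_def A_B Y_iff)
    ultimately have "S1 x - A (D x) = F (R x) + F ?z" by simp
    then show ?thesis using F_span by (simp add: span_add)
  qed
  then show ?thesis
    using trace bD DX J(1) S1_Y
    by (elim exE) (intro exI[of _ D] exI[of _ "(\<lambda>k. S1 (g k)) ` J"] exI, auto)
qed

lemma index_formula: "of_int (R_Ind U P R) = trace_H0 (P \<circ> K2 \<circ> P) - trace_H0 (R \<circ> K1 \<circ> R)"
proof -
  interpret pair: vector_space_pair scale scale ..
  obtain D C t where bD: "H0.bounded_op D" and DX: "\<And>x. x \<in> H 0 \<Longrightarrow> D x \<in> X"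
    and t: "H0.has_trace (\<lambda>x. A (D x)) t" "H0.has_trace (\<lambda>x. D (A x)) t"
    and C: "finite C" "C \<subseteq> Y" and F1_span: "\<And>x. x \<in> H 0 \<Longrightarrow> S1 x - A (D x) \<in> span C"
    using finite_rank_correction by blast
  have XH: "x \<in> H 0" if "x \<in> X" for x using that H_inf_in by (simp add: X_iff)
  have YH: "y \<in> H 0" if "y \<in> Y" for y using that H_inf_in by (simp add: Y_iff)
  have AH: "A x \<in> H 0" if "x \<in> H 0" for x using H0.bounded_op_in[OF bounded_A that] .
  define Y0 where "Y0 = span C"
  define X0 where "X0 = {x \<in> X. A x \<in> Y0}"
  define F1 where "F1 x = S1 x - A (D x)" for x
  define F2 where "F2 x = S2 x - D (A x)" for x
  define B' where "B' y = B y + D y" for y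
  have subY0: "subspace Y0" unfolding Y0_def by (rule subspace_span)
  have Y0_Y: "Y0 \<subseteq> Y" unfolding Y0_def using C(2) subspace_Y by (rule span_minimal)
  have subX0: "subspace X0"
  proof -
    have "X0 = X \<inter> {x. A x \<in> Y0}" by (auto simp: X0_def)
    then show ?thesis
      using subspace_inter[OF subspace_X
          pair.linear_subspace_linear_preimage[OF tame_operator_linear[OF tame_A] subY0]] by simp
  qed
  have X0_X: "X0 \<subseteq> X" by (auto simp: X0_def)
  have F1_Y0: "F1 x \<in> Y0" if "x \<in> H 0" for x
    unfolding F1_def Y0_def using F1_span[OF that] .
  have F2_X0: "F2 x \<in> X0" if x: "x \<in> H 0" for x
  proof -
    have "F2 x \<in> X"
      unfolding F2_def by (rule subspace_diff[OF subspace_X S2_X DX[OF AH[OF x]]])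
    \<comment> \<open>This intertwining, inherited from \<open>A_S2\<close>, forces the values of
      \<open>F2\<close> into the preimage of \<open>Y0\<close>.\<close>
    moreover have "A (F2 x) = F1 (A x)" by (simp add: F1_def F2_def A_simps A_S2)
    ultimately show ?thesis using F1_Y0[OF AH[OF x]] by (simp add: X0_def)
  qed
  have B'_A: "B' (A x) = x - F2 x" if "x \<in> X" for x
    using that by (simp add: B'_def F2_def B_A X_iff)
  have A_B': "A (B' y) = y - F1 y" if "y \<in> Y" for y
    using that by (simp add: B'_def F1_def A_B A_simps Y_iff)
  have B'_X: "B' y \<in> X" if "y \<in> Y" for y
    unfolding B'_def using that B_Y DX YH by (intro subspace_add[OF subspace_X]) (auto simp: Y_iff)
  have B'_X0: "B' y \<in> X0" if y: "y \<in> Y0" for y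
  proof -
    have yY: "y \<in> Y" using y Y0_Y by blast
    have "A (B' y) \<in> Y0"
      unfolding A_B'[OF yY] by (rule subspace_diff[OF subY0 y F1_Y0[OF YH[OF yY]]])
    then show ?thesis using B'_X[OF yY] by (simp add: X0_def)
  qed

  \<comment> \<open>By regularity the kernel is smooth, so the passage from \<open>H 0\<close> to
    \<open>X\<close> loses none of it.\<close>
  have kerX0: "{x \<in> X0. A x = 0} = N"
    using N_in_H_inf subspace_0[OF subY0] XH
    by (auto simp: X0_def N_def X_iff range_P_iff)
  obtain FN where FN: "finite FN" "span FN = N" using finite_dim_N by blast
  have AX0: "A ` X0 \<subseteq> span C" by (auto simp: X0_def Y0_def)
  have kerX0': "{x \<in> X0. A x = 0} \<subseteq> span FN" unfolding kerX0 FN(2) ..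
  obtain GX where GX: "finite GX" "span GX = X0"
    using pair.rank_nullity_on(1)[OF tame_operator_linear[OF tame_A] subX0 FN(1) kerX0' C(1) AX0]
    by blast
  have dimX0: "dim X0 = dim N + dim (A ` X0)"
    using pair.rank_nullity_on(2)[OF tame_operator_linear[OF tame_A] subX0 FN(1) kerX0' C(1) AX0]
    unfolding kerX0 .

  define Z where "Z = A ` (H 0 \<inter> range P)"
  define W where "W = Dom0 U \<inter> range R"
  have subZ: "subspace Z"
    unfolding Z_def
    by (rule pair.linear_subspace_image[OF tame_operator_linear[OF tame_A]
          subspace_inter[OF subspace_H subspace_range[OF tame_ops(1)]]])
  have UA: "U (A x) = P x - K2 (P x)" for x
    using UT[of "P x"] by (simp add: pair_op_P)
  have K2H: "K2 x \<in> H 0" for x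
    using H_inf_in[OF smoothing_in_H_inf[OF smoothing_K(2)]] .
  have PH: "P x \<in> H 0" if "x \<in> H 0" for x using H0.bounded_op_in[OF bounded_P that] .
  \<comment> \<open>\<open>U\<close> may be unbounded, but \<open>U A\<close> is P - K2 P and hence
    bounded on \<open>H 0\<close>. So \<open>A\<close> carries smooth approximations of
    \<open>x\<close> to approximations of \<open>A x\<close> in the graph norm, which is membership
    in \<open>Dom0 U\<close>; the same bound later gives continuity into
    \<open>Dom0 U\<close>.\<close>
  have bUA: "H0.bounded_op (\<lambda>x. U (A x))"
    unfolding UA
    by (rule H0.bounded_op_diff_op[OF bounded_P
          H0.bounded_op_comp[OF smoothing_bounded_op[OF smoothing_K(2)] bounded_P]])
  have Z_W: "Z \<subseteq> W"
  proof
    fix y assume "y \<in> Z"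
    then obtain x where x: "x \<in> H 0" "y = A x" unfolding Z_def by blast
    obtain xs where xs: "range xs \<subseteq> H_inf" "converges_in (H 0) (ip 0) xs x"
      using H_inf_approximation[OF x(1)] by blast
    obtain C1 where C1: "\<And>x. x \<in> H 0 \<Longrightarrow> nrm (ip 0) (A x) \<le> C1 * nrm (ip 0) x"
      using H0.bounded_op_bound[OF bounded_A] by blast
    obtain C2 where C2: "\<And>x. x \<in> H 0 \<Longrightarrow> nrm (ip 0) (U (A x)) \<le> C2 * nrm (ip 0) x"
      using H0.bounded_op_bound[OF bUA] by blast
    have "converges_in (H 0) (ip 0) (\<lambda>n. A (xs n)) (A x)"
      by (rule H0.converges_in_bounded_image[OF xs(2) AH H0.bounded_op_diff[OF bounded_A] C1])
    moreover have "converges_in (H 0) (ip 0) (\<lambda>n. U (A (xs n))) (U (A x))"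
      by (rule H0.converges_in_bounded_image[OF xs(2) H0.bounded_op_in[OF bUA]
            H0.bounded_op_diff[OF bUA] C2])
    moreover have "range (\<lambda>n. A (xs n)) \<subseteq> H_inf"
      using xs(1) tame_operator_H_inf[OF tame_A] by blast
    ultimately have "A x \<in> Dom0 U"
      unfolding Dom0_def mem_Collect_eq by (intro exI[of _ "\<lambda>n. A (xs n)"]) simp
    then show "y \<in> W" using x(2) by (simp add: W_def range_R_iff)
  qed
  have Y_W: "Y \<subseteq> W"
    using Dom0_H_inf[OF tame_ops(3)] by (auto simp: W_def Y_iff range_R_iff)
  have W_eq: "W = {z + y |z y. z \<in> Z \<and> y \<in> Y0}"
  proof
    show "W \<subseteq> {z + y |z y. z \<in> Z \<and> y \<in> Y0}"
    proof
      fix w assume "w \<in> W"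
      then have w: "w \<in> Dom0 U" "R w = w" by (auto simp: W_def range_R_iff)
      \<comment> \<open>\<open>A (B w)\<close> misses \<open>w\<close> by the smooth vector
        \<open>?s\<close>, and the corrected parametrix solves for \<open>?s\<close> up to
        \<open>F1 ?s\<close>, which lies in \<open>Y0\<close>. That \<open>w\<close> is in
        \<open>Dom0 U\<close> puts \<open>U w\<close>, and so \<open>B w\<close>, into
        \<open>H 0\<close>.\<close>
      let ?s = "S1 w"
      have sY: "?s \<in> Y" by (rule S1_Y)
      have Bw: "B w \<in> H 0 \<inter> range P"
        using PH[OF Dom0_D(2)[OF w(1)]] w(2) by (simp add: B_def)
      have "B' ?s \<in> H 0 \<inter> range P"
        using B'_X[OF sY] XH by (auto simp: X_def)
      then have "B w + B' ?s \<in> H 0 \<inter> range P"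
        using Bw subspace_add[OF subspace_inter[OF subspace_H subspace_range[OF tame_ops(1)]]] by blast
      then have "A (B w + B' ?s) \<in> Z" unfolding Z_def by blast
      moreover have "w = A (B w + B' ?s) + F1 ?s"
        using w(2) by (simp add: A_simps A_B A_B'[OF sY])
      ultimately show "w \<in> {z + y |z y. z \<in> Z \<and> y \<in> Y0}"
        using F1_Y0[OF YH[OF sY]] by blast
    qed
    show "{z + y |z y. z \<in> Z \<and> y \<in> Y0} \<subseteq> W"
    proof clarify
      fix z y assume "z \<in> Z" "y \<in> Y0"
      then have "z \<in> W" "y \<in> W" using Z_W Y_W Y0_Y by blast+
      then show "z + y \<in> W"
        using Dom0_add[OF tame_ops(3)] subspace_add[OF subspace_range[OF tame_ops(2)]]
        by (simp add: W_def)
    qed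
  qed
  \<comment> \<open>The elements of \<open>Y0\<close> are smooth, so by regularity their preimages
    in the range of \<open>P\<close> are smooth and belong to \<open>X0\<close>.\<close>
  have Z_Y0: "Z \<inter> Y0 = A ` X0"
  proof
    show "A ` X0 \<subseteq> Z \<inter> Y0" using XH by (auto simp: X0_def X_def Z_def)
    show "Z \<inter> Y0 \<subseteq> A ` X0"
    proof
      fix y assume y: "y \<in> Z \<inter> Y0"
      then obtain x' where "x' \<in> range P" "y = A x'" unfolding Z_def by blast
      then obtain x where x: "P x = x" "A x = y" using range_P_iff by metis
      have "y \<in> H_inf" using y Y0_Y by (auto simp: Y_iff)
      then have "U y + K2 x \<in> H_inf"
        using tame_operator_H_inf[OF tame_ops(3)] smoothing_in_H_inf[OF smoothing_K(2)]
        by (intro subspace_add[OF subspace_H_inf])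
      then have "x \<in> X" using preimage_eq[OF x] x(1) by (simp add: X_iff)
      then show "y \<in> A ` X0" using x y by (auto simp: X0_def)
    qed
  qed
  have "Y0 \<subseteq> span C" by (simp add: Y0_def)
  note qb = quotient_dim_sum(1)[OF subZ subY0 C(1) this W_eq]
    and qd = quotient_dim_sum(2)[OF subZ subY0 C(1) this W_eq, unfolded Z_Y0]

  have fred: "fredholm (H 0 \<inter> range P) (nrm (ip 0)) W (nrm (Dom0_ip U)) A"
    unfolding fredholm_def
  proof (intro conjI)
    show "A ` (H 0 \<inter> range P) \<subseteq> W" using Z_W unfolding Z_def .
    show "linear_on (H 0 \<inter> range P) A" by (simp add: linear_on_def A_simps)
    show "finite_dim {x \<in> H 0 \<inter> range P. A x = 0}"
      using finite_dim_N unfolding finite_dim_def N_def .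
    show "\<exists>B. quotient_basis W (A ` (H 0 \<inter> range P)) B" using qb unfolding Z_def .
    obtain C1 where C1: "0 \<le> C1" "\<And>x. x \<in> H 0 \<Longrightarrow> nrm (ip 0) (A x) \<le> C1 * nrm (ip 0) x"
      using H0.bounded_op_bound[OF bounded_A] by blast
    obtain C2 where C2: "0 \<le> C2" "\<And>x. x \<in> H 0 \<Longrightarrow> nrm (ip 0) (U (A x)) \<le> C2 * nrm (ip 0) x"
      using H0.bounded_op_bound[OF bUA] by blast
    have "nrm (Dom0_ip U) (A x) \<le> (C1 + C2) * nrm (ip 0) x" if x: "x \<in> H 0" for x
    proof -
      have V: "A x \<in> H 0" "U (A x) \<in> H 0" using AH[OF x] H0.bounded_op_in[OF bUA x] .
      have "nrm (Dom0_ip U) (A x) = sqrt ((nrm (ip 0) (A x))\<^sup>2 + (nrm (ip 0) (U (A x)))\<^sup>2)"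
        unfolding H0.nrm_power2[OF V(1)] H0.nrm_power2[OF V(2)] by (simp add: nrm_def Dom0_ip_def)
      also have "\<dots> \<le> nrm (ip 0) (A x) + nrm (ip 0) (U (A x))"
        using V by (intro sqrt_sum_squares_le_sum) simp_all
      also have "\<dots> \<le> C1 * nrm (ip 0) x + C2 * nrm (ip 0) x"
        using C1(2)[OF x] C2(2)[OF x] by (rule add_mono)
      finally show ?thesis by (simp add: distrib_right)
    qed
    then show "\<exists>C. \<forall>x\<in>H 0 \<inter> range P. nrm (Dom0_ip U) (A x) \<le> C * nrm (ip 0) x" by blast
  qed
  have RP: "R \<circ> P = A" by (simp add: fun_eq_iff A_def)
  have "R_Ind U P R = int (dim N) - int (quotient_dim W Z)"
    using fred unfolding R_Ind_def RP fredholm_index_def W_def[symmetric] N_def Z_def by simp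
  then have ind: "R_Ind U P R = int (dim X0) - int (dim Y0)" using dimX0 qd by simp

  obtain BX where BX: "finite BX" "H0.orthonormal BX" "span BX = X0"
    using H0.exists_orthonormal_of_finite[OF GX(1)] GX(2) X0_X XH span_superset[of GX] by blast
  obtain BY where BY: "finite BY" "H0.orthonormal BY" "span BY = Y0"
    using H0.exists_orthonormal_of_finite[OF C(1)] C(2) YH unfolding Y0_def by blast
  have dims: "dim X0 = card BX" "dim Y0 = card BY"
    using dim_span_eq_card_independent[OF H0.orthonormal_independent] BX BY by metis+
  have BX_in: "e \<in> X0" if "e \<in> BX" for e using that BX(3) span_base by blast
  have BY_in: "e \<in> Y0" if "e \<in> BY" for e using that BY(3) span_base by blast
  have bF1: "H0.bounded_op F1" and bF2: "H0.bounded_op F2"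
    unfolding F1_def[abs_def] F2_def[abs_def]
    using H0.bounded_op_diff_op[OF bounded_S1 H0.bounded_op_comp[OF bounded_A bD]]
      H0.bounded_op_diff_op[OF bounded_S2 H0.bounded_op_comp[OF bD bounded_A]] .
  have trF1: "H0.has_trace F1 (\<Sum>e\<in>BY. ip 0 (F1 e) e)"
    using H0.finite_rank_has_trace[OF bF1 BY(2,1)] F1_Y0 BY(3) by blast
  have trF2: "H0.has_trace F2 (\<Sum>e\<in>BX. ip 0 (F2 e) e)"
    using H0.finite_rank_has_trace[OF bF2 BX(2,1)] F2_X0 BX(3) by blast
  have "(\<Sum>e\<in>BX. ip 0 (B' (A e)) e) = (\<Sum>e\<in>BY. ip 0 (A (B' e)) e)"
  proof (rule H0.finite_trace_commute[OF BX(2,1) BY(2,1)], unfold BX(3) BY(3))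
    show "linear_on X0 A" by (simp add: linear_on_def A_simps)
    show "A ` X0 \<subseteq> Y0" using AX0 unfolding Y0_def .
    show "B' ` Y0 \<subseteq> X0" using B'_X0 by blast
    have "y \<in> H 0" if "y \<in> Y0" for y using that Y0_Y YH by blast
    then show "linear_on Y0 B'"
      by (simp add: linear_on_def B'_def B_simps H0.bounded_op_add[OF bD]
          H0.bounded_op_scale[OF bD] scale_right_distrib)
  qed
  moreover have "(\<Sum>e\<in>BX. ip 0 (B' (A e)) e) = of_nat (card BX) - (\<Sum>e\<in>BX. ip 0 (F2 e) e)"
  proof -
    have "ip 0 (B' (A e)) e = 1 - ip 0 (F2 e) e" if e: "e \<in> BX" for e
    proof -
      have eX: "e \<in> X" using BX_in[OF e] X0_X by blast
      have "F2 e \<in> H 0" using F2_X0[OF XH[OF eX]] X0_X XH by blast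
      then show ?thesis
        using XH[OF eX] H0.orthonormal_ip[OF BX(2) e e] by (simp add: B'_A[OF eX] H0.form_diff_left)
    qed
    then show ?thesis by (simp add: sum_subtractf)
  qed
  moreover have "(\<Sum>e\<in>BY. ip 0 (A (B' e)) e) = of_nat (card BY) - (\<Sum>e\<in>BY. ip 0 (F1 e) e)"
  proof -
    have "ip 0 (A (B' e)) e = 1 - ip 0 (F1 e) e" if e: "e \<in> BY" for e
    proof -
      have eY: "e \<in> Y" using BY_in[OF e] Y0_Y by blast
      have "F1 e \<in> H 0" using F1_Y0[OF YH[OF eY]] Y0_Y YH by blast
      then show ?thesis
        using YH[OF eY] H0.orthonormal_ip[OF BY(2) e e] by (simp add: A_B'[OF eY] H0.form_diff_left)
    qed
    then show ?thesis by (simp add: sum_subtractf)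
  qed
  ultimately have sums: "(\<Sum>e\<in>BX. ip 0 (F2 e) e) - (\<Sum>e\<in>BY. ip 0 (F1 e) e) =
      of_nat (card BX) - of_nat (card BY)"
    by (simp add: algebra_simps)

  obtain t1 t2 where t1: "H0.has_trace S1 t1" and t2: "H0.has_trace S2 t2"
    using smoothing_nuclear_rep[OF smoothing_S1] smoothing_nuclear_rep[OF smoothing_S2]
      H0.nuclear_has_trace by blast
  \<comment> \<open>The trace class property provides an orthonormal basis of \<open>H 0\<close>, by
    which the values of traces can be compared.\<close>
  obtain E where E: "H0.orthonormal_basis E"
    using smoothing_trace_class[OF smoothing_S1, of 0] unfolding H0.trace_class_def by blast
  have DH: "D x \<in> H 0" if "x \<in> H 0" for x using H0.bounded_op_in[OF bD that] .
  have "H0.has_trace F1 (t1 - t)"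
    unfolding F1_def[abs_def]
    using H0.has_trace_diff[OF t1 t(1)] H0.bounded_op_in[OF bounded_S1] AH DH by blast
  then have F1_tr: "t1 - t = (\<Sum>e\<in>BY. ip 0 (F1 e) e)"
    using H0.op_trace_eq[OF _ E] trF1 by metis
  have "H0.has_trace F2 (t2 - t)"
    unfolding F2_def[abs_def]
    using H0.has_trace_diff[OF t2 t(2)] H0.bounded_op_in[OF bounded_S2] AH DH by blast
  then have F2_tr: "t2 - t = (\<Sum>e\<in>BX. ip 0 (F2 e) e)"
    using H0.op_trace_eq[OF _ E] trF2 by metis
  have S: "P \<circ> K2 \<circ> P = S2" "R \<circ> K1 \<circ> R = S1"
    by (simp_all add: fun_eq_iff S1_def S2_def)
  have "trace_H0 (P \<circ> K2 \<circ> P) - trace_H0 (R \<circ> K1 \<circ> R) = t2 - t1"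
    unfolding trace_H0_def S H0.op_trace_eq[OF t1 E] H0.op_trace_eq[OF t2 E] ..
  also have "\<dots> = (t2 - t) - (t1 - t)" by simp
  also have "\<dots> = of_nat (card BX) - of_nat (card BY)" unfolding F1_tr F2_tr by (rule sums)
  finally show ?thesis unfolding ind dims by simp
qed

end

theorem theorem15:
  fixes scale :: "complex \<Rightarrow> 'a::ab_group_add \<Rightarrow> 'a"
    and H :: "real \<Rightarrow> 'a set"
    and ip :: "real \<Rightarrow> 'a \<Rightarrow> 'a \<Rightarrow> complex"
    and P R U K1 K2 :: "'a \<Rightarrow> 'a"
  assumes "tame_setting scale H ip"
    and "hilbert_scale.tame_fredholm_pair scale H ip P R"
    and "hilbert_scale.parametrix scale H ip (hilbert_scale.pair_op P R) U K1 K2"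
  shows "of_int (hilbert_scale.R_Ind scale H ip U P R) =
         hilbert_scale.trace_H0 scale H ip (P \<circ> K2 \<circ> P)
         - hilbert_scale.trace_H0 scale H ip (R \<circ> K1 \<circ> R)"
proof -
  interpret tame_setting scale H ip by (rule assms(1))
  interpret fredholm_pair_setting scale H ip P R U K1 K2
    by unfold_locales (fact assms)+
  show ?thesis by (rule index_formula)
qed

end
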